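(* Let $K$ be a zonoid in $\mathbb{R}^n$ and let $m\in\{1,\dots,n-2\}$. Then $$V_m(K)^2\ge \frac{1}{n-m}\sum_{i=1}^nV_m(K|e_i^{\perp})^2.$$
   Context: $e_1,\dots,e_n$ is the standard orthonormal basis of $\mathbb{R}^n$, $e_i^\perp$ is the $i$th coordinate hyperplane, and $K|e_i^\perp$ is the orthogonal projection of $K$ on $e_i^\perp$. $V_m$ denotes the $m$th intrinsic volume: for nonempty compact convex $K\subset\mathbb{R}^n$, the numbers $V_0(K),\dots,V_n(K)$ are defined by the Steiner formula $\mathcal{H}^n(K+tB^n)=\sum_{i=0}^n\kappa_{n-i}V_i(K)t^{n-i}$, $t\ge0$, where $B^n$ is the unit ball and $\kappa_k$ is the volume of the unit ball in $\mathbb{R}^k$; $V_i(K)$ does not depend on the ambient space. A zonotope is a finite Minkowski sum of line segments; a zonoid is a limit, in the Hausdorff metric, of zonotopes. (Up to translation, a zonoid $K$ has support function $h_K(u)=\int_{S^{n-1}}|u\cdot v|\,d\mu_K(v)$ for a finite even Borel measure $\mu_K$ on $S^{n-1}$, its generating measure.) *)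

theory Defs
  imports "HOL-Analysis.Analysis"
begin

definition zonotope :: "'a::euclidean_space set \<Rightarrow> bool"
  where "zonotope Z \<longleftrightarrow>
    (\<exists>(k::nat) a b. Z = (\<Sum>i<k. closed_segment (a i) (b i)))"

text \<open>This is the Hausdorff metric for nonempty compact sets only; \<open>infdist\<close> and \<open>SUP\<close> are underspecified on empty or unbounded ones.\<close>

definition hausdorff_dist :: "'a::metric_space set \<Rightarrow> 'a set \<Rightarrow> real"
  where "hausdorff_dist A B = max (SUP a\<in>A. infdist a B) (SUP b\<in>B. infdist b A)"

text \<open>The limit is taken in the metric space of convex bodies (nonempty compact convex sets).\<close>

definition zonoid :: "'a::euclidean_space set \<Rightarrow> bool"
  where "zonoid K \<longleftrightarrow> K \<noteq> {} \<and> compact K \<and> convex K \<and>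
    (\<exists>Z. (\<forall>k::nat. zonotope (Z k)) \<and> (\<lambda>k. hausdorff_dist (Z k) K) \<longlonglongrightarrow> 0)"

text \<open>
  \<open>steiner_coeffs K V\<close>: the numbers \<open>V 0, \<dots>, V n\<close> satisfy Steiner's formula for \<open>K\<close> in
  \<open>n\<close>-dimensional space. The \<open>V i\<close> with \<open>i > n\<close>, which do not occur in the formula, are set
  to \<open>0\<close>, so that \<open>V\<close> is determined by \<open>K\<close> (lemma \<open>steiner_coeffs_unique\<close>).
\<close>

definition steiner_coeffs :: "'a::euclidean_space set \<Rightarrow> (nat \<Rightarrow> real) \<Rightarrow> bool"
  where "steiner_coeffs K V \<longleftrightarrow>
    (\<forall>i>DIM('a). V i = 0) \<and>
    (\<forall>t\<ge>0. measure lebesgue (K + (\<lambda>x. t *\<^sub>R x) ` cball 0 1) =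
      (\<Sum>i=0..DIM('a). unit_ball_vol (real (DIM('a) - i)) * V i * t ^ (DIM('a) - i)))"

definition intrinsic_volume :: "nat \<Rightarrow> 'a::euclidean_space set \<Rightarrow> real"
  where "intrinsic_volume m K = (THE V. steiner_coeffs K V) m"

definition orth_proj :: "'a::euclidean_space set \<Rightarrow> 'a \<Rightarrow> 'a"
  where "orth_proj S x = (THE y. y \<in> S \<and> x - y \<in> orthogonal_comp S)"

lemma steiner_coeffs_unique:
  fixes K :: "'a::euclidean_space set"
  assumes V: "steiner_coeffs K V" and W: "steiner_coeffs K W"
  shows "V = W"
proof
  fix j
  define n where "n = DIM('a)"
  define c where "c k = unit_ball_vol (real k) * (V (n - k) - W (n - k))" for k
  have rev: "(\<Sum>i=0..n. g i * t ^ (n - i)) = (\<Sum>k\<le>n. g (n - k) * t ^ k)" for g and t :: real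
    unfolding atLeast0AtMost
    by (rule sum.reindex_bij_witness[of _ "\<lambda>k. n - k" "\<lambda>k. n - k"]; simp)
  have "(\<Sum>k\<le>n. c k * t ^ k) = 0" if "t \<ge> 0" for t
  proof -
    have "(\<Sum>i=0..n. (unit_ball_vol (real (n - i)) * V i) * t ^ (n - i)) =
        (\<Sum>i=0..n. (unit_ball_vol (real (n - i)) * W i) * t ^ (n - i))"
      using V W that by (simp add: steiner_coeffs_def n_def)
    then show ?thesis
      unfolding rev by (simp add: c_def algebra_simps sum_subtractf)
  qed
  then have "{0..} \<subseteq> {t. (\<Sum>k\<le>n. c k * t ^ k) = 0}"
    by auto
  then have "infinite {t. (\<Sum>k\<le>n. c k * t ^ k) = 0}"
    using infinite_Ici infinite_super by blast
  then have c0: "c k = 0" if "k \<le> n" for k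
    using that polyfun_finite_roots[of c n] by auto
  show "V j = W j"
  proof (cases "j \<le> n")
    case True
    have "unit_ball_vol (real (n - j)) \<noteq> 0"
      using unit_ball_vol_pos[of "real (n - j)"] by linarith
    then show ?thesis
      using c0[of "n - j"] True by (simp add: c_def del: of_nat_diff)
  next
    case False
    then show ?thesis
      using V W by (simp add: steiner_coeffs_def n_def)
  qed
qed

lemma intrinsic_volume_eq:
  assumes "steiner_coeffs K V"
  shows "intrinsic_volume m K = V m"
  unfolding intrinsic_volume_def
  by (subst the_equality[of "steiner_coeffs K" V]) (auto intro: assms steiner_coeffs_unique)

lemma orth_proj_coordinate_hyperplane:
  fixes x :: "real ^ 'n"
  shows "orth_proj (orthogonal_comp {axis i 1}) x = x - (x $ i) *\<^sub>R axis i 1"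
  unfolding orth_proj_def
proof (rule the_equality)
  let ?S = "orthogonal_comp {axis i 1 :: real ^ 'n}"
  have S: "z \<in> ?S \<longleftrightarrow> z $ i = 0" for z
    by (simp add: orthogonal_comp_def orthogonal_def inner_axis')
  show p: "x - (x $ i) *\<^sub>R axis i 1 \<in> ?S \<and> x - (x - (x $ i) *\<^sub>R axis i 1) \<in> orthogonal_comp ?S"
    using S by (auto simp: orthogonal_comp_def[of ?S] orthogonal_def inner_axis)
  fix y
  assume y: "y \<in> ?S \<and> x - y \<in> orthogonal_comp ?S"
  define w where "w = y - (x - (x $ i) *\<^sub>R axis i 1)"
  have "w \<in> ?S"
    using y p unfolding S w_def by simp
  moreover have "w \<in> orthogonal_comp ?S"
  proof -
    have "w = (x - (x - (x $ i) *\<^sub>R axis i 1)) - (x - y)"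
      by (simp add: w_def)
    then show ?thesis
      using subspace_diff[OF subspace_orthogonal_comp conjunct2[OF p] conjunct2[OF y]] by simp
  qed
  ultimately have "orthogonal w w"
    unfolding orthogonal_comp_def[of ?S] by blast
  then have "w = 0"
    by (simp add: orthogonal_self)
  then show "y = x - (x $ i) *\<^sub>R axis i 1"
    by (simp add: w_def)
qed

end

theory Submission
  imports Defs
begin

text \<open>
  For a zonotope \<open>Z = [0, v\<^sub>1] + \<dots> + [0, v\<^sub>k]\<close>, expanding the volume of \<open>Z + t B\<close> segment by segment
  writes \<open>V\<^sub>m(Z)\<close> as a constant times the sum of \<open>\<Phi>(S)\<close> over the \<open>m\<close>-element sublists \<open>S\<close>
  of generators, where \<open>\<Phi>(S)\<close> is a multiple of the \<open>m\<close>-dimensional volume of the parallelepiped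
  spanned by \<open>S\<close>. Projecting \<open>S\<close> along \<open>e\<^sub>i\<close> multiplies \<open>\<Phi>(S)\<close> by the distance from \<open>e\<^sub>i\<close> to the span of \<open>S\<close>,
  and the squares of these \<open>n\<close> distances add up to \<open>n - m\<close>. The vectors
  \<open>(\<Phi>(S projected along e\<^sub>i))\<^sub>i\<close> therefore have length \<open>sqrt (n - m) \<Phi>(S)\<close>, and the triangle inequality
  proves the claim for zonotopes. Volumes of \<open>K + t B\<close> with \<open>t > 0\<close> are continuous in the Hausdorff metric,
  and their coefficients as polynomials in \<open>t\<close> are recovered by interpolation, so the claim passes to zonoids.
\<close>

section \<open>Iterated volume differences along segments\<close>

abbreviation vol :: "'a::euclidean_space set \<Rightarrow> real"
  where "vol \<equiv> measure lebesgue"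

definition convex_body :: "'a::euclidean_space set \<Rightarrow> bool"
  where "convex_body L \<longleftrightarrow> compact L \<and> convex L"

definition seg :: "'a::real_vector \<Rightarrow> 'a set"
  where "seg v = closed_segment 0 v"

lemma compact_set_plus:
  fixes S T :: "'a::real_normed_vector set"
  assumes "compact S" "compact T"
  shows "compact (S + T)"
  using compact_sums[OF assms] by (simp add: set_plus_def Bex_def conj_ac)

lemma mem_seg: "x \<in> seg v \<longleftrightarrow> (\<exists>r. 0 \<le> r \<and> r \<le> 1 \<and> x = r *\<^sub>R v)"
  by (auto simp: seg_def closed_segment_def)

lemma mem_seg_scaleR:
  assumes "0 \<le> s"
  shows "x \<in> seg (s *\<^sub>R v) \<longleftrightarrow> (\<exists>r. 0 \<le> r \<and> r \<le> s \<and> x = r *\<^sub>R v)"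
proof (cases "s = 0")
  case False
  show ?thesis
  proof
    assume "x \<in> seg (s *\<^sub>R v)"
    then obtain r where r: "0 \<le> r" "r \<le> 1" "x = r *\<^sub>R s *\<^sub>R v"
      by (auto simp: mem_seg)
    then have "0 \<le> r * s" "r * s \<le> s" "x = (r * s) *\<^sub>R v"
      using assms by (auto simp: mult_left_le_one_le)
    then show "\<exists>r. 0 \<le> r \<and> r \<le> s \<and> x = r *\<^sub>R v" by blast
  next
    assume "\<exists>r. 0 \<le> r \<and> r \<le> s \<and> x = r *\<^sub>R v"
    then obtain r where r: "0 \<le> r" "r \<le> s" "x = r *\<^sub>R v" by blast
    then have "0 \<le> r / s" "r / s \<le> 1" "x = (r / s) *\<^sub>R s *\<^sub>R v"
      using assms False by auto
    then show "x \<in> seg (s *\<^sub>R v)"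
      unfolding mem_seg by blast
  qed
qed (auto simp: mem_seg)

lemma convex_body_plus: "convex_body S \<Longrightarrow> convex_body T \<Longrightarrow> convex_body (S + T)"
  by (simp add: convex_body_def compact_set_plus convex_set_plus)

lemma convex_body_seg [simp]: "convex_body (seg v)"
  by (simp add: convex_body_def seg_def)

lemma convex_body_plus_seg [simp]: "convex_body S \<Longrightarrow> convex_body (S + seg v)"
  by (simp add: convex_body_plus)

lemma convex_body_singleton [simp]: "convex_body {a}"
  by (simp add: convex_body_def)

lemma convex_body_cball [simp]: "convex_body (cball a r)"
  by (simp add: convex_body_def)

lemma convex_body_lmeasurable: "convex_body S \<Longrightarrow> S \<in> lmeasurable"
  by (simp add: convex_body_def lmeasurable_compact)

lemma vol_mono: "convex_body S \<Longrightarrow> convex_body T \<Longrightarrow> S \<subseteq> T \<Longrightarrow> vol S \<le> vol T"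
  by (meson convex_body_lmeasurable fmeasurableD measure_mono_fmeasurable)

lemma singleton_plus: "{a} + S = (+) a ` S"
  by (auto simp: set_plus_def)

lemma vol_singleton_plus: "vol ({a} + S) = vol S"
  by (simp add: singleton_plus measure_translation)

lemma seg_0 [simp]: "seg 0 = {0}"
  by (simp add: seg_def)

lemma set_plus_seg_0 [simp]: "L + seg 0 = (L :: 'a::real_vector set)"
  by (metis seg_0 set_zero add_0_right)

lemma zero_in_seg [simp]: "0 \<in> seg v"
  by (simp add: seg_def)

lemma set_plus_seg_superset: "L \<subseteq> L + seg v"
  using set_zero_plus2[of "seg v" L] by (simp add: add.commute)

lemma mem_set_plus_iff: "x \<in> A + B \<longleftrightarrow> (\<exists>b\<in>B. x - b \<in> A)"
  for A B :: "'a::ab_group_add set"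
  by (metis diff_add_cancel add_diff_cancel_right' set_plus_elim set_plus_intro)

text \<open>The longer sweep of \<open>L\<close> is the union of the sweep by s v and the sweep by t
  v translated by s v. By convexity these overlap exactly in the translate of \<open>L\<close> by s
  v, and inclusion-exclusion gives the identity.\<close>

lemma vol_plus_seg_add:
  assumes L: "convex_body L" and st: "0 \<le> s" "0 \<le> t"
  shows "vol (L + seg ((s + t) *\<^sub>R v)) + vol L = vol (L + seg (s *\<^sub>R v)) + vol (L + seg (t *\<^sub>R v))"
proof -
  have mem: "x \<in> L + seg (s *\<^sub>R v) \<longleftrightarrow> (\<exists>r. 0 \<le> r \<and> r \<le> s \<and> x - r *\<^sub>R v \<in> L)" if "s \<ge> 0" for s x
    unfolding mem_set_plus_iff Bex_def mem_seg_scaleR[OF that] by blast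
  let ?X = "L + seg (s *\<^sub>R v)" and ?Y = "(+) (s *\<^sub>R v) ` (L + seg (t *\<^sub>R v))"
  have memY: "x \<in> ?Y \<longleftrightarrow> (\<exists>r. s \<le> r \<and> r \<le> s + t \<and> x - r *\<^sub>R v \<in> L)" for x
  proof -
    have "x \<in> ?Y \<longleftrightarrow> x - s *\<^sub>R v \<in> L + seg (t *\<^sub>R v)"
      by (force simp: image_iff)
    also have "\<dots> \<longleftrightarrow> (\<exists>r. 0 \<le> r \<and> r \<le> t \<and> x - (s + r) *\<^sub>R v \<in> L)"
      using st by (simp add: mem algebra_simps)
    also have "\<dots> \<longleftrightarrow> (\<exists>r. s \<le> r \<and> r \<le> s + t \<and> x - r *\<^sub>R v \<in> L)"
    proof
      assume "\<exists>r. 0 \<le> r \<and> r \<le> t \<and> x - (s + r) *\<^sub>R v \<in> L"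
      then obtain r where "0 \<le> r" "r \<le> t" "x - (s + r) *\<^sub>R v \<in> L" by blast
      then show "\<exists>r. s \<le> r \<and> r \<le> s + t \<and> x - r *\<^sub>R v \<in> L"
        by (intro exI[of _ "s + r"]) auto
    next
      assume "\<exists>r. s \<le> r \<and> r \<le> s + t \<and> x - r *\<^sub>R v \<in> L"
      then obtain r where "s \<le> r" "r \<le> s + t" "x - r *\<^sub>R v \<in> L" by blast
      then show "\<exists>r. 0 \<le> r \<and> r \<le> t \<and> x - (s + r) *\<^sub>R v \<in> L"
        by (intro exI[of _ "r - s"]) auto
    qed
    finally show ?thesis .
  qed
  have U: "L + seg ((s + t) *\<^sub>R v) = ?X \<union> ?Y"
  proof (intro set_eqI)
    fix x
    have "(\<exists>r. 0 \<le> r \<and> r \<le> s + t \<and> P r) \<longleftrightarrow>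
        (\<exists>r. 0 \<le> r \<and> r \<le> s \<and> P r) \<or> (\<exists>r. s \<le> r \<and> r \<le> s + t \<and> P r)" for P
      using st by (meson add_increasing2 order_trans linear)
    then show "x \<in> L + seg ((s + t) *\<^sub>R v) \<longleftrightarrow> x \<in> ?X \<union> ?Y"
      unfolding Un_iff memY using st by (simp only: mem add_nonneg_nonneg)
  qed
  have I: "?X \<inter> ?Y = (+) (s *\<^sub>R v) ` L"
  proof (intro set_eqI iffI)
    fix x assume "x \<in> ?X \<inter> ?Y"
    then obtain r r' where r: "r \<le> s" "x - r *\<^sub>R v \<in> L" "s \<le> r'" "x - r' *\<^sub>R v \<in> L"
      using mem memY st by auto
    have "x - s *\<^sub>R v \<in> L"
    proof (cases "r = r'")
      case True then show ?thesis using r by (metis antisym)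
    next
      case False
      \<comment> \<open>The weight that writes \<open>s\<close> as a convex combination of
        \<open>r\<close> and \<open>r'\<close>, so that x - s v lies on a chord of
        \<open>L\<close>.\<close>
      define u where "u = (s - r) / (r' - r)"
      have u: "0 \<le> u" "u \<le> 1" "s = (1 - u) * r + u * r'"
      proof -
        have "u * (r' - r) = s - r" using False by (simp add: u_def)
        then show "s = (1 - u) * r + u * r'" by (simp add: algebra_simps)
      qed (use r False in \<open>auto simp: u_def\<close>)
      have "(1 - u) *\<^sub>R (x - r *\<^sub>R v) + u *\<^sub>R (x - r' *\<^sub>R v) \<in> L"
        using L r u by (intro convexD_alt) (auto simp: convex_body_def)
      also have "(1 - u) *\<^sub>R (x - r *\<^sub>R v) + u *\<^sub>R (x - r' *\<^sub>R v) = x - s *\<^sub>R v"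
        unfolding u(3) by (simp add: algebra_simps)
      finally show ?thesis .
    qed
    then show "x \<in> (+) (s *\<^sub>R v) ` L"
      by (force simp: image_iff)
  next
    fix x assume "x \<in> (+) (s *\<^sub>R v) ` L"
    then have "x - s *\<^sub>R v \<in> L" by auto
    then show "x \<in> ?X \<inter> ?Y"
      using st by (auto simp: mem memY)
  qed
  have m: "?X \<in> lmeasurable" "?Y \<in> lmeasurable"
    using L by (auto intro!: convex_body_lmeasurable measurable_translation)
  show ?thesis
    unfolding U measure_Un3[OF m] I by (simp add: measure_translation)
qed

text \<open>Additivity settles integer multiples, and nonnegativity makes \<open>h\<close> monotone.
  Squeezing N s between consecutive integers bounds N times the defect by \<open>h 1\<close> for
  every N, so the defect is zero.\<close>

lemma additive_mono_imp_linear: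
  fixes h :: "real \<Rightarrow> real"
  assumes add: "\<And>s t. 0 \<le> s \<Longrightarrow> 0 \<le> t \<Longrightarrow> h (s + t) = h s + h t"
    and nonneg: "\<And>s. 0 \<le> s \<Longrightarrow> 0 \<le> h s" and s: "0 \<le> s"
  shows "h s = s * h 1"
proof -
  have h0: "h 0 = 0" using add[of 0 0] by simp
  have mono: "h x \<le> h y" if "0 \<le> x" "x \<le> y" for x y
    using add[of x "y - x"] nonneg[of "y - x"] that by simp
  have nat: "h (real N * x) = real N * h x" if "0 \<le> x" for N x
  proof (induction N)
    case (Suc N)
    have "h (real (Suc N) * x) = h (real N * x + x)" by (simp add: algebra_simps)
    also have "\<dots> = h (real N * x) + h x" using that by (intro add) auto
    finally show ?case using Suc by (simp add: algebra_simps)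
  qed (simp add: h0)
  have h1: "0 \<le> h 1" by (simp add: nonneg)
  have bound: "real N * \<bar>h s - s * h 1\<bar> \<le> h 1" for N
  proof -
    define k where "k = nat \<lfloor>real N * s\<rfloor>"
    have k: "real k \<le> real N * s" "real N * s \<le> real k + 1"
      using s unfolding k_def by (auto simp: of_nat_nat)
    have lo: "real k * h 1 \<le> real N * h s"
      using mono[of "real k" "real N * s"] k s nat[of 1 k] nat[of s N] by simp
    have hi: "real N * h s \<le> (real k + 1) * h 1"
      using mono[of "real N * s" "real (Suc k)"] k s nat[of 1 "Suc k"] nat[of s N] by (simp add: add.commute)
    have "real k * h 1 \<le> real N * s * h 1" "real N * s * h 1 \<le> (real k + 1) * h 1"
      using k h1 by (auto intro: mult_right_mono)
    then have "\<bar>real N * h s - real N * s * h 1\<bar> \<le> h 1"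
      using lo hi by (simp add: algebra_simps)
    then show ?thesis
      using abs_mult[of "real N" "h s - s * h 1"] by (simp add: right_diff_distrib mult.assoc)
  qed
  show ?thesis
  proof (rule ccontr)
    assume "h s \<noteq> s * h 1"
    then obtain N where "h 1 < real N * \<bar>h s - s * h 1\<bar>"
      using reals_Archimedean3[of "\<bar>h s - s * h 1\<bar>"] by auto
    with bound[of N] show False by simp
  qed
qed

lemma vol_plus_seg_affine:
  assumes L: "convex_body L" and s: "0 \<le> s"
  shows "vol (L + seg (s *\<^sub>R v)) - vol L = s * (vol (L + seg v) - vol L)"
proof -
  have "(\<lambda>s. vol (L + seg (s *\<^sub>R v)) - vol L) s = s * (\<lambda>s. vol (L + seg (s *\<^sub>R v)) - vol L) 1"
  proof (rule additive_mono_imp_linear)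
    show "vol (L + seg ((s + t) *\<^sub>R v)) - vol L =
        vol (L + seg (s *\<^sub>R v)) - vol L + (vol (L + seg (t *\<^sub>R v)) - vol L)"
      if "0 \<le> s" "0 \<le> t" for s t
      using vol_plus_seg_add[OF L that, of v] by simp
    show "0 \<le> vol (L + seg (s *\<^sub>R v)) - vol L" for s
      using vol_mono[OF L _ set_plus_seg_superset] L by simp
  qed (rule s)
  then show ?thesis by simp
qed

text \<open>\<open>mixed_diff [v\<^sub>1, \<dots>, v\<^sub>m] L\<close> is, up to a constant, the mixed volume of \<open>m\<close> segments and \<open>n - m\<close> copies of \<open>L\<close>.\<close>

fun mixed_diff :: "'a::euclidean_space list \<Rightarrow> 'a set \<Rightarrow> real"
  where
    "mixed_diff [] L = vol L"
  | "mixed_diff (v # vs) L = mixed_diff vs (L + seg v) - mixed_diff vs L"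

text \<open>The base case is linearity of the volume gain; a further difference along
  \<open>w\<close> preserves it because Minkowski addition commutes. So
  \<open>mixed_diff (v # vs)\<close> is the slope of \<open>mixed_diff vs\<close> in direction
  \<open>v\<close>.\<close>

lemma mixed_diff_affine:
  assumes "convex_body L" and "0 \<le> s"
  shows "mixed_diff vs (L + seg (s *\<^sub>R v)) - mixed_diff vs L = s * mixed_diff (v # vs) L"
  using assms(1)
proof (induction vs arbitrary: L)
  case Nil
  then show ?case using vol_plus_seg_affine assms(2) by simp
next
  case (Cons w vs)
  have "L + seg w + seg (s *\<^sub>R v) = L + seg (s *\<^sub>R v) + seg w" "L + seg w + seg v = L + seg v + seg w"
    by (simp_all add: add_ac)
  then show ?case
    using Cons.IH[of L] Cons.IH[of "L + seg w"] Cons.prems by (simp add: algebra_simps)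
qed

lemma mixed_diff_swap: "mixed_diff (v # w # vs) L = mixed_diff (w # v # vs) L"
  by (simp add: add.commute add.left_commute)

lemma mixed_diff_move: "mixed_diff (us @ v # vs) L = mixed_diff (v # us @ vs) L"
proof (induction us arbitrary: L)
  case (Cons u us)
  have "mixed_diff ((u # us) @ v # vs) L = mixed_diff (u # v # us @ vs) L"
    using Cons by simp
  then show ?case by (metis mixed_diff_swap append_Cons)
qed simp

text \<open>The induction hypothesis, applied to both bodies swept by s v, compares two affine
  functions of \<open>s\<close> on a half-line; their growth for large \<open>s\<close> compares the
  slopes.\<close>

lemma mixed_diff_mono:
  assumes "convex_body L" "convex_body L'" "L \<subseteq> L'"
  shows "mixed_diff vs L \<le> mixed_diff vs L'"
  using assms
proof (induction vs arbitrary: L L')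
  case Nil
  then show ?case by (simp add: vol_mono)
next
  case (Cons v vs)
  have *: "mixed_diff vs L + s * mixed_diff (v # vs) L \<le> mixed_diff vs L' + s * mixed_diff (v # vs) L'"
    if "0 \<le> s" for s
    using mixed_diff_affine[of L s vs v] mixed_diff_affine[of L' s vs v] that
      Cons.IH[of "L + seg (s *\<^sub>R v)" "L' + seg (s *\<^sub>R v)"] Cons.prems
    by (simp add: set_plus_mono2 del: mixed_diff.simps)
  show ?case
  proof (rule ccontr)
    assume "\<not> ?thesis"
    then have d: "0 < mixed_diff (v # vs) L - mixed_diff (v # vs) L'" (is "0 < ?d") by simp
    obtain N :: nat where "mixed_diff vs L' - mixed_diff vs L < real N * ?d"
      using reals_Archimedean3[OF d] by blast
    with *[of "real N"] show False by (simp add: algebra_simps del: mixed_diff.simps)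
  qed
qed

lemma mixed_diff_singleton_plus: "mixed_diff vs ({a} + L) = mixed_diff vs L"
  by (induction vs arbitrary: L) (simp_all add: vol_singleton_plus add.assoc)

section \<open>Sign changes, scaling and shears of the vectors\<close>

lemma seg_minus: "seg (- v) = {- v} + seg v"
proof -
  have "x \<in> seg (- v) \<longleftrightarrow> x + v \<in> seg v" for x
  proof
    assume "x \<in> seg (- v)"
    then obtain r where r: "0 \<le> r" "r \<le> 1" "x = r *\<^sub>R (- v)" by (auto simp: mem_seg)
    then have "x + v = (1 - r) *\<^sub>R v" by (simp add: algebra_simps)
    then show "x + v \<in> seg v" unfolding mem_seg using r by (intro exI[of _ "1 - r"]) auto
  next
    assume "x + v \<in> seg v"
    then obtain r where r: "0 \<le> r" "r \<le> 1" "x + v = r *\<^sub>R v" by (auto simp: mem_seg)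
    then have "x = (1 - r) *\<^sub>R (- v)"
      by (simp add: algebra_simps eq_diff_eq)
    then show "x \<in> seg (- v)" unfolding mem_seg using r by (intro exI[of _ "1 - r"]) auto
  qed
  then have "x \<in> seg (- v) \<longleftrightarrow> x \<in> {- v} + seg v" for x
    by (simp add: add.commute[of "{- v}"] mem_set_plus_iff)
  then show ?thesis by blast
qed

lemma mixed_diff_uminus: "mixed_diff (- v # vs) L = mixed_diff (v # vs) L"
proof -
  have "L + seg (- v) = {- v} + (L + seg v)" by (simp add: seg_minus add_ac)
  then show ?thesis by (simp add: mixed_diff_singleton_plus)
qed

lemma mixed_diff_scaleR:
  assumes "convex_body L"
  shows "mixed_diff (s *\<^sub>R v # vs) L = \<bar>s\<bar> * mixed_diff (v # vs) L"
proof (cases "0 \<le> s")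
  case True
  then show ?thesis using mixed_diff_affine[OF assms True, of vs v] by simp
next
  case False
  then show ?thesis
    using mixed_diff_affine[OF assms, of "- s" vs v] mixed_diff_uminus[of "s *\<^sub>R v" vs L] by simp
qed

text \<open>\<open>mixed_diff vs\<close> is affine in direction \<open>v\<close>, so its increment
  over one further copy of \<open>seg v\<close> does not depend on the starting point. Negative
  \<open>c\<close> is reduced to this by reversing \<open>v\<close>.\<close>

lemma mixed_diff_absorb:
  assumes "convex_body L"
  shows "mixed_diff (v # vs) (L + seg (c *\<^sub>R v)) = mixed_diff (v # vs) L"
proof -
  have pos: "mixed_diff (v # vs) (L + seg (c *\<^sub>R v)) = mixed_diff (v # vs) L" if c0: "0 \<le> c" for c v
  proof -
    have "L + seg (c *\<^sub>R v) + seg v = L + seg ((c + 1) *\<^sub>R v)"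
    proof -
      have "seg (c *\<^sub>R v) + seg v = seg ((c + 1) *\<^sub>R v)"
      proof (intro set_eqI iffI)
        fix x assume "x \<in> seg (c *\<^sub>R v) + seg v"
        then obtain a b where ab: "a \<in> seg (c *\<^sub>R v)" "b \<in> seg v" "x = a + b"
          by (rule set_plus_elim)
        from ab(1) obtain r where "0 \<le> r" "r \<le> c" "a = r *\<^sub>R v"
          unfolding mem_seg_scaleR[OF c0] by blast
        moreover from ab(2) obtain q where "0 \<le> q" "q \<le> 1" "b = q *\<^sub>R v"
          unfolding mem_seg by blast
        ultimately have "0 \<le> r + q" "r + q \<le> c + 1" "x = (r + q) *\<^sub>R v"
          using ab(3) by (auto simp: scaleR_left_distrib)
        then show "x \<in> seg ((c + 1) *\<^sub>R v)"
          using c0 by (subst mem_seg_scaleR) auto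
      next
        fix x assume "x \<in> seg ((c + 1) *\<^sub>R v)"
        then obtain r where r: "0 \<le> r" "r \<le> c + 1" "x = r *\<^sub>R v"
          using mem_seg_scaleR[of "c + 1" x v] c0 by auto
        have "x = min r c *\<^sub>R v + (r - min r c) *\<^sub>R v"
          using r by (simp flip: scaleR_left_distrib)
        moreover have "min r c *\<^sub>R v \<in> seg (c *\<^sub>R v)"
          unfolding mem_seg_scaleR[OF c0] using r c0 by (intro exI[of _ "min r c"]) auto
        moreover have "(r - min r c) *\<^sub>R v \<in> seg v"
          using r by (auto simp: mem_seg intro!: exI[of _ "r - min r c"])
        ultimately show "x \<in> seg (c *\<^sub>R v) + seg v" by auto
      qed
      then show ?thesis by (simp add: add.assoc)
    qed
    moreover have "mixed_diff vs (L + seg ((c + 1) *\<^sub>R v)) - mixed_diff vs L = (c + 1) * mixed_diff (v # vs) L"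
      "mixed_diff vs (L + seg (c *\<^sub>R v)) - mixed_diff vs L = c * mixed_diff (v # vs) L"
      using c0 by (auto intro!: mixed_diff_affine assms simp del: mixed_diff.simps)
    ultimately show ?thesis by (simp add: algebra_simps)
  qed
  show ?thesis
  proof (cases "0 \<le> c")
    case False
    then show ?thesis
      using pos[of "- c" "- v"] by (simp add: mixed_diff_uminus del: mixed_diff.simps)
  qed (rule pos)
qed

text \<open>The sheared segment lies in the parallelogram
  \<open>seg w + seg (c *\<^sub>R v)\<close>, and the extra segment parallel to \<open>v\<close> is
  absorbed because \<open>v\<close> is in the list.\<close>

lemma mixed_diff_shear_le:
  assumes "convex_body L"
  shows "mixed_diff ((w + c *\<^sub>R v) # v # vs) L \<le> mixed_diff (w # v # vs) L"
proof -
  have "seg (w + c *\<^sub>R v) \<subseteq> seg w + seg (c *\<^sub>R v)"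
    by (auto simp: mem_seg scaleR_right_distrib intro!: set_plus_intro) blast+
  then have "L + seg (w + c *\<^sub>R v) \<subseteq> L + seg w + seg (c *\<^sub>R v)"
    by (simp add: add.assoc set_plus_mono2)
  then have "mixed_diff (v # vs) (L + seg (w + c *\<^sub>R v)) \<le> mixed_diff (v # vs) (L + seg w + seg (c *\<^sub>R v))"
    using assms by (intro mixed_diff_mono) auto
  also have "\<dots> = mixed_diff (v # vs) (L + seg w)"
    using assms by (intro mixed_diff_absorb) auto
  finally show ?thesis by simp
qed

text \<open>A shear is undone by the opposite shear, so the one-sided bound holds in both
  directions.\<close>

lemma mixed_diff_shear:
  assumes "convex_body L"
  shows "mixed_diff ((w + c *\<^sub>R v) # v # vs) L = mixed_diff (w # v # vs) L"
  using mixed_diff_shear_le[OF assms, of w c v vs] mixed_diff_shear_le[OF assms, of "w + c *\<^sub>R v" "- c" v vs]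
  by (simp del: mixed_diff.simps)

text \<open>The element \<open>p\<close> is removed one multiple of a list member at a time; that
  member is first moved to second place, where \<open>mixed_diff_shear\<close> applies.\<close>

lemma mixed_diff_shear_span:
  assumes "convex_body L" and p: "p \<in> span (set vs)"
  shows "mixed_diff ((w + p) # vs) L = mixed_diff (w # vs) L"
  using p
proof (induction arbitrary: w rule: span_induct_alt)
  case base
  then show ?case by simp
next
  case (step c x y)
  then obtain us ws where vs: "vs = us @ x # ws" by (metis split_list)
  have "mixed_diff ((w + (c *\<^sub>R x + y)) # vs) L = mixed_diff (((w + c *\<^sub>R x) + y) # vs) L"
    by (simp add: add.assoc)
  also have "\<dots> = mixed_diff ((w + c *\<^sub>R x) # vs) L"
    by (rule step)
  also have "\<dots> = mixed_diff ((w + c *\<^sub>R x) # x # us @ ws) L"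
    using mixed_diff_move[of "(w + c *\<^sub>R x) # us" x ws L] mixed_diff_swap unfolding vs
    by (metis append_Cons)
  also have "\<dots> = mixed_diff (w # x # us @ ws) L"
    by (rule mixed_diff_shear[OF assms(1)])
  also have "\<dots> = mixed_diff (w # vs) L"
    using mixed_diff_move[of "w # us" x ws L] mixed_diff_swap unfolding vs
    by (metis append_Cons)
  finally show ?case .
qed

text \<open>With \<open>e\<close> in the list, the other vectors may be changed freely along
  \<open>e\<close>; later this exchanges vectors for their projections along
  \<open>e\<close>.\<close>

lemma mixed_diff_map_shear:
  assumes "convex_body L"
  shows "mixed_diff (e # map (\<lambda>x. x + f x *\<^sub>R e) vs) L = mixed_diff (e # vs) L"
  using assms
proof (induction vs arbitrary: L)
  case (Cons v vs)
  let ?vs = "map (\<lambda>x. x + f x *\<^sub>R e) vs"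
  have "mixed_diff (e # (v + f v *\<^sub>R e) # ?vs) L = mixed_diff ((v + f v *\<^sub>R e) # e # ?vs) L"
    by (rule mixed_diff_swap)
  also have "\<dots> = mixed_diff (v # e # ?vs) L"
    by (rule mixed_diff_shear[OF Cons.prems])
  also have "\<dots> = mixed_diff (v # e # vs) L"
    using Cons.IH[of L] Cons.IH[of "L + seg v"] Cons.prems by simp
  also have "\<dots> = mixed_diff (e # v # vs) L"
    by (rule mixed_diff_swap)
  finally show ?case by simp
qed simp

section \<open>Sums of segments and orthogonal invariance of the volume\<close>

definition seg_sum :: "'a::euclidean_space list \<Rightarrow> 'a set"
  where "seg_sum vs = sum_list (map seg vs)"

lemma seg_sum_Nil [simp]: "seg_sum [] = {0}"
  by (simp add: seg_sum_def)

lemma seg_sum_Cons [simp]: "seg_sum (v # vs) = seg v + seg_sum vs"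
  by (simp add: seg_sum_def)

lemma convex_body_seg_sum [simp]: "convex_body (seg_sum vs)"
  by (induction vs) (simp_all add: convex_body_plus)

lemma mixed_diff_nonneg:
  assumes "convex_body L"
  shows "0 \<le> mixed_diff vs L"
proof (cases vs)
  case (Cons v ws)
  then show ?thesis
    using mixed_diff_mono[of L "L + seg v" ws] assms set_plus_seg_superset[of L v] by simp
qed simp

lemma set_plus_zero [simp]: "L + {0} = L" "{0} + L = L" for L :: "'a::comm_monoid_add set"
  by (auto simp: set_plus_def)

text \<open>Each segment splits a term into its value without the segment plus a difference along
  it. Over all segments this yields one term per sublist, the analogue of expanding a volume into
  mixed volumes.\<close>

lemma vol_plus_seg_sum: "vol (L + seg_sum vs) = (\<Sum>us\<leftarrow>subseqs vs. mixed_diff us L)"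
proof (induction vs arbitrary: L)
  case (Cons v vs)
  have "vol (L + seg_sum (v # vs)) = (\<Sum>us\<leftarrow>subseqs vs. mixed_diff us (L + seg v))"
    using Cons[of "L + seg v"] by (simp add: add.assoc)
  also have "\<dots> = (\<Sum>us\<leftarrow>subseqs vs. mixed_diff (v # us) L + mixed_diff us L)"
    by simp
  also have "\<dots> = (\<Sum>us\<leftarrow>subseqs (v # vs). mixed_diff us L)"
    by (simp add: Let_def sum_list_addf o_def del: mixed_diff.simps)
  finally show ?case .
qed simp

lemma mixed_diff_append_le:
  assumes "convex_body L"
  shows "mixed_diff (vs @ ws) L \<le> mixed_diff ws (L + seg_sum vs)"
  using assms
proof (induction vs arbitrary: L)
  case (Cons v vs)
  have "mixed_diff ((v # vs) @ ws) L \<le> mixed_diff (vs @ ws) (L + seg v)"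
    using mixed_diff_nonneg[OF Cons.prems, of "vs @ ws"] by simp
  also have "\<dots> \<le> mixed_diff ws (L + seg v + seg_sum vs)"
    using Cons by simp
  finally show ?case by (simp add: add.assoc)
qed simp

lemma seg_subset_subspace: "subspace S \<Longrightarrow> v \<in> S \<Longrightarrow> seg v \<subseteq> S"
  by (auto simp: mem_seg subspace_scale)

text \<open>All bodies that occur stay inside the proper subspace \<open>S\<close> and so are null
  sets.\<close>

lemma mixed_diff_eq_0_lowdim:
  assumes "subspace S" "dim S < DIM('a)" "L \<subseteq> S" "set vs \<subseteq> S"
  shows "mixed_diff vs (L :: 'a::euclidean_space set) = 0"
  using assms(3,4)
proof (induction vs arbitrary: L)
  case Nil
  have "negligible L"
    using Nil assms(2) by (intro negligible_lowdim) (metis le_less_trans[OF dim_subset])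
  then show ?case by (simp add: negligible_imp_measure0)
next
  case (Cons v vs)
  have "L + seg v \<subseteq> S"
    using Cons.prems assms(1) seg_subset_subspace[of S v]
    by (auto elim!: set_plus_elim intro!: subspace_add)
  then show ?case
    using Cons by simp
qed

lemma mixed_diff_singleton_short:
  assumes "length vs < DIM('a)"
  shows "mixed_diff vs {0 :: 'a::euclidean_space} = 0"
proof (rule mixed_diff_eq_0_lowdim)
  have "dim (span (set vs)) \<le> card (set vs)"
    by (simp add: dim_le_card')
  then show "dim (span (set vs)) < DIM('a)"
    using assms card_length[of vs] by simp
qed (auto simp: span_zero span_base)

lemma sum_list_subseqs_eq:
  fixes g :: "'b list \<Rightarrow> 'a::comm_monoid_add"
  assumes "\<And>us. length us < length vs \<Longrightarrow> g us = 0"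
  shows "(\<Sum>us\<leftarrow>subseqs vs. g us) = g vs"
  using assms
proof (induction vs arbitrary: g)
  case (Cons v vs)
  have len: "length us \<le> length vs" if "us \<in> set (subseqs vs)" for us
    using that by (induction vs arbitrary: us) (fastforce simp: Let_def)+
  have "map g (subseqs vs) = map (\<lambda>_. 0) (subseqs vs)"
    using Cons.prems len by (intro map_cong) (auto simp: less_Suc_eq_le)
  then have "(\<Sum>us\<leftarrow>subseqs vs. g us) = 0"
    by (metis sum_list_0)
  then show ?case
    using Cons.IH[of "\<lambda>us. g (v # us)"] Cons.prems by (simp add: Let_def o_def)
qed simp

lemma vol_seg_sum:
  fixes vs :: "'a::euclidean_space list"
  assumes "length vs \<le> DIM('a)"
  shows "vol (seg_sum vs) = mixed_diff vs {0}"
proof -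
  have "vol (seg_sum vs) = (\<Sum>us\<leftarrow>subseqs vs. mixed_diff us {0})"
    using vol_plus_seg_sum[of "{0}" vs] by simp
  also have "\<dots> = mixed_diff vs {0}"
    using assms by (intro sum_list_subseqs_eq mixed_diff_singleton_short) simp
  finally show ?thesis .
qed

lemma mixed_diff_map_scaleR:
  assumes "convex_body L"
  shows "mixed_diff (map (\<lambda>x. s x *\<^sub>R g x) xs) L = (\<Prod>x\<leftarrow>xs. \<bar>s x\<bar>) * mixed_diff (map g xs) L"
  using assms
proof (induction xs arbitrary: L)
  case (Cons x xs)
  have "mixed_diff (map (\<lambda>x. s x *\<^sub>R g x) (x # xs)) L =
      \<bar>s x\<bar> * mixed_diff (g x # map (\<lambda>x. s x *\<^sub>R g x) xs) L"
    using mixed_diff_scaleR[OF Cons.prems] by simp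
  also have "\<dots> = \<bar>s x\<bar> * ((\<Prod>x\<leftarrow>xs. \<bar>s x\<bar>) * mixed_diff (g x # map g xs) L)"
    using Cons.IH[of L] Cons.IH[of "L + seg (g x)"] Cons.prems by (simp add: right_diff_distrib)
  finally show ?case by simp
qed simp

section \<open>Linear images and the constant by which they scale volume\<close>

lemma linear_image_set_plus: "linear f \<Longrightarrow> f ` (A + B) = f ` A + f ` B"
  by (force simp: set_plus_def linear_add image_iff)

lemma linear_image_seg: "linear f \<Longrightarrow> f ` seg v = seg (f v)"
  using closed_segment_linear_image[of f 0 v] by (simp add: seg_def linear_0)

lemma linear_image_seg_sum: "linear f \<Longrightarrow> f ` seg_sum vs = seg_sum (map f vs)"
  by (induction vs) (simp_all add: linear_image_set_plus linear_image_seg linear_0)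

lemma mixed_diff_linear_image:
  assumes f: "linear f" and c: "\<And>L. convex_body L \<Longrightarrow> vol (f ` L) = c * vol L" and L: "convex_body L"
  shows "mixed_diff (map f vs) (f ` L) = c * mixed_diff vs L"
  using L
proof (induction vs arbitrary: L)
  case (Cons v vs)
  then show ?case
    using Cons.IH[of "L + seg v"]
    by (simp add: right_diff_distrib linear_image_set_plus[OF f] linear_image_seg[OF f])
qed (simp add: c)

lemma cbox_eq_seg_sum:
  fixes s :: "'a::euclidean_space \<Rightarrow> real"
  assumes bs: "distinct bs" "set bs = Basis" and s: "\<And>b. b \<in> Basis \<Longrightarrow> 0 \<le> s b"
  shows "cbox 0 (\<Sum>b\<in>Basis. s b *\<^sub>R b) = seg_sum (map (\<lambda>b. s b *\<^sub>R b) bs)"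
proof -
  have "cbox 0 (\<Sum>b\<in>Basis. s b *\<^sub>R b) = {x. \<forall>b\<in>Basis. x \<bullet> b \<in> {0..s b}}"
    by (auto simp: mem_box)
  also have "\<dots> = (\<Sum>b\<in>Basis. (\<lambda>x. x *\<^sub>R b) ` {0..s b})"
    by (rule box_eq_set_sum_Basis)
  also have "\<dots> = (\<Sum>b\<in>Basis. seg (s b *\<^sub>R b))"
  proof (rule sum.cong)
    fix b :: 'a assume "b \<in> Basis"
    show "(\<lambda>x. x *\<^sub>R b) ` {0..s b} = seg (s b *\<^sub>R b)"
      unfolding set_eq_iff mem_seg_scaleR[OF s[OF \<open>b \<in> Basis\<close>]] by auto
  qed simp
  also have "\<dots> = seg_sum (map (\<lambda>b. s b *\<^sub>R b) bs)"
    unfolding seg_sum_def using bs by (simp add: sum.distinct_set_conv_list o_def flip: bs(2))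
  finally show ?thesis .
qed

text \<open>The image of a box is a translated sum of segments in the directions \<open>f b\<close>,
  and homogeneity extracts the side lengths. The constant \<open>mixed_diff (map f bs) {0}\<close>
  stands for |det f|.\<close>

lemma vol_linear_image_cbox:
  fixes f :: "'a::euclidean_space \<Rightarrow> 'a"
  assumes f: "linear f" and bs: "distinct bs" "set bs = Basis" and le: "\<And>b. b \<in> Basis \<Longrightarrow> l \<bullet> b \<le> u \<bullet> b"
  shows "vol (f ` cbox l u) = mixed_diff (map f bs) {0} * (\<Prod>b\<in>Basis. (u - l) \<bullet> b)"
proof -
  define s where "s b = (u - l) \<bullet> b" for b
  have s: "0 \<le> s b" if "b \<in> Basis" for b
    using le[OF that] by (simp add: s_def inner_diff_left)
  have "cbox l u = (+) l ` cbox 0 (u - l)"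
    using cbox_translation[of l 0 "u - l"] by simp
  also have "u - l = (\<Sum>b\<in>Basis. s b *\<^sub>R b)"
    by (simp add: s_def euclidean_representation)
  also have "cbox 0 \<dots> = seg_sum (map (\<lambda>b. s b *\<^sub>R b) bs)"
    by (rule cbox_eq_seg_sum[OF bs s])
  finally have "f ` cbox l u = {f l} + seg_sum (map (\<lambda>b. s b *\<^sub>R f b) bs)"
    using linear_image_set_plus[OF f, of "{l}"]
    by (simp add: singleton_plus[symmetric] linear_image_seg_sum[OF f] o_def linear_cmul[OF f])
  then have "vol (f ` cbox l u) = vol (seg_sum (map (\<lambda>b. s b *\<^sub>R f b) bs))"
    by (simp add: vol_singleton_plus)
  also have "\<dots> = mixed_diff (map (\<lambda>b. s b *\<^sub>R f b) bs) {0}"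
    using distinct_card[OF bs(1)] bs(2) by (intro vol_seg_sum) simp
  also have "\<dots> = (\<Prod>b\<leftarrow>bs. \<bar>s b\<bar>) * mixed_diff (map f bs) {0}"
    by (rule mixed_diff_map_scaleR) simp
  also have "(\<Prod>b\<leftarrow>bs. \<bar>s b\<bar>) = (\<Prod>b\<in>Basis. s b)"
    using bs s by (simp add: prod.distinct_set_conv_list[symmetric])
  finally show ?thesis by (simp add: s_def)
qed

text \<open>
  \<open>measure_orthogonal_image\<close> is restricted to \<open>real ^ 'n\<close> with well-ordered \<open>'n\<close>. Here a linear bijection scales
  the volume of boxes, hence of all Borel sets, by a constant, which the unit ball shows to be \<open>1\<close>.
\<close>

lemma vol_orthogonal_transformation:
  fixes f :: "'a::euclidean_space \<Rightarrow> 'a"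
  assumes f: "orthogonal_transformation f" and L: "compact L"
  shows "vol (f ` L) = vol L"
proof -
  have lin: "linear f" and bij: "bij f"
    using f by (auto simp: orthogonal_transformation_linear orthogonal_transformation_bij)
  define g where "g = inv f"
  have g: "orthogonal_transformation g"
    using f by (simp add: g_def orthogonal_transformation_inv)
  have vim: "g -` A = f ` A" for A
    using bij by (simp add: g_def bij_vimage_eq_inv_image bij_imp_bij_inv inv_inv_eq)
  have gm: "g \<in> borel_measurable borel"
    using g by (intro borel_measurable_continuous_onI linear_continuous_on)
      (simp add: orthogonal_transformation_linear linear_conv_bounded_linear[symmetric])
  obtain bs :: "'a list" where bs: "distinct bs" "set bs = Basis"
    using finite_distinct_list[OF finite_Basis] by blast
  define c where "c = mixed_diff (map f bs) {0}"
  define M where "M = distr lborel borel g"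
  have M: "emeasure M A = emeasure lborel (f ` A)" if "A \<in> sets borel" for A
    unfolding M_def using that gm by (simp add: emeasure_distr vim)
  have fborel: "f ` A \<in> sets borel" if "A \<in> sets borel" for A
    using measurable_sets[OF gm that] by (simp add: vim)
  \<comment> \<open>Open boxes are what characterises \<open>lborel\<close>; their images differ
    from those of the closed boxes only within the frontier of a convex set, which is
    negligible.\<close>
  have c: "vol (f ` box l u) = c * (\<Prod>b\<in>Basis. (u - l) \<bullet> b)"
    if "\<And>b. b \<in> Basis \<Longrightarrow> l \<bullet> b < u \<bullet> b" for l u
  proof -
    have ne: "box l u \<noteq> {}" using that by (simp add: box_ne_empty)
    have "bounded (f ` box l u)"
      using lin bounded_box by (simp add: bounded_linear_image linear_conv_bounded_linear[symmetric])
    moreover have "convex (f ` box l u)"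
      using lin by (simp add: convex_linear_image convex_box)
    ultimately have "vol (closure (f ` box l u)) = vol (f ` box l u)"
      by (intro measure_closure negligible_convex_frontier)
    moreover have "closure (f ` box l u) = f ` cbox l u"
      using closure_injective_linear_image[OF lin, of "box l u"] bij ne
      by (simp add: bij_is_inj)
    ultimately show ?thesis
      using vol_linear_image_cbox[OF lin bs, of l u] that by (simp add: c_def less_imp_le)
  qed
  have bm: "f ` box l u \<in> lmeasurable" for l u
    using lin fborel[of "box l u"] bounded_box
    by (intro bounded_set_imp_lmeasurable bounded_linear_image) (auto simp: linear_conv_bounded_linear[symmetric])
  have "c > 0"
  proof -
    have "open (f ` box 0 One)"
      using lin bij by (intro open_surjective_linear_image) (auto simp: bij_is_surj)
    moreover have "f ` box 0 One \<noteq> {}" 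
      by (simp add: box_ne_empty)
    ultimately have "vol (f ` box 0 One) \<noteq> 0"
      using bm[of 0 One] open_not_negligible negligible_iff_measure by blast
    then have "c \<noteq> 0" using c[of 0 One] by auto
    then show ?thesis using mixed_diff_nonneg[of "{0}" "map f bs"] by (simp add: c_def)
  qed
  have "lborel = scale_measure (ennreal (1 / c)) M"
  proof (rule lborel_eqI)
    fix l u :: 'a assume lu: "\<And>b. b \<in> Basis \<Longrightarrow> l \<bullet> b \<le> u \<bullet> b"
    show "emeasure (scale_measure (ennreal (1 / c)) M) (box l u) = ennreal (\<Prod>b\<in>Basis. (u - l) \<bullet> b)"
    proof (cases "\<forall>b\<in>Basis. l \<bullet> b < u \<bullet> b")
      case True
      have "emeasure M (box l u) = emeasure lebesgue (f ` box l u)"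
        by (simp add: M fborel)
      also have "\<dots> = ennreal (vol (f ` box l u))"
        using bm by (simp add: emeasure_eq_measure2)
      also have "\<dots> = ennreal (c * (\<Prod>b\<in>Basis. (u - l) \<bullet> b))"
        using True by (simp add: c)
      finally show ?thesis
        using \<open>c > 0\<close> by (simp flip: ennreal_mult')
    next
      case False
      then obtain b where b: "b \<in> Basis" "l \<bullet> b = u \<bullet> b" using lu by (meson antisym_conv2)
      then have "box l u = {}" "(\<Prod>b\<in>Basis. (u - l) \<bullet> b) = 0"
        by (auto simp: box_eq_empty inner_diff_left intro!: bexI[of _ b])
      then show ?thesis by (simp only: emeasure_empty ennreal_0)
    qed
  qed (simp add: M_def)
  then have fL: "emeasure lborel A = ennreal (1 / c) * emeasure lborel (f ` A)" if "A \<in> sets borel" for A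
    using M[OF that] by (metis emeasure_scale_measure)
  have vol: "vol A = 1 / c * vol (f ` A)" if "A \<in> sets borel" for A
    using fL[OF that] that fborel[OF that] \<open>c > 0\<close>
    by (simp add: measure_def enn2real_mult)
  have "vol (f ` cball 0 1) = vol (cball 0 1 :: 'a set)"
    using image_orthogonal_transformation_cball[OF f, of 0 1] lin by (simp add: linear_0)
  then have "c = 1"
    using vol[of "cball 0 1 :: 'a set"] content_cball_pos[of 1 "0::'a"] \<open>c > 0\<close> by (simp add: field_simps)
  then show ?thesis using vol[of L] L by (simp add: borel_compact)
qed

lemma mixed_diff_orthogonal_transformation:
  fixes f :: "'a::euclidean_space \<Rightarrow> 'a"
  assumes "orthogonal_transformation f" "convex_body L"
  shows "mixed_diff (map f vs) (f ` L) = mixed_diff vs L"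
proof -
  have "vol (f ` K) = 1 * vol K" if "convex_body K" for K
    using vol_orthogonal_transformation[OF assms(1), of K] that by (simp add: convex_body_def)
  then show ?thesis
    using mixed_diff_linear_image[OF orthogonal_transformation_linear[OF assms(1)] _ assms(2), of 1]
    by simp
qed

section \<open>Orthonormal lists\<close>

fun orthonormal :: "'a::real_inner list \<Rightarrow> bool"
  where
    "orthonormal [] \<longleftrightarrow> True"
  | "orthonormal (v # vs) \<longleftrightarrow> norm v = 1 \<and> (\<forall>x\<in>set vs. v \<bullet> x = 0) \<and> orthonormal vs"

text \<open>The map is the reflection in the hyperplane orthogonal to \<open>a - b\<close>. It takes
  \<open>a\<close> to \<open>b\<close> because they have equal length, and it is the identity when
  they coincide.\<close>

lemma reflection_swapping:
  fixes a b :: "'a::real_inner"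
  assumes "norm a = norm b"
  obtains f where "orthogonal_transformation f" "f a = b" "\<And>x. x \<bullet> (a - b) = 0 \<Longrightarrow> f x = x"
proof
  define d where "d = a - b"
  let ?f = "\<lambda>x. x - (2 * (x \<bullet> d) / (d \<bullet> d)) *\<^sub>R d"
  have "linear ?f"
    by (rule linearI) (simp_all add: inner_add_left algebra_simps add_divide_distrib)
  moreover have "?f v \<bullet> ?f w = v \<bullet> w" for v w
    by (cases "d = 0") (simp_all add: inner_diff_left inner_diff_right inner_commute field_simps)
  ultimately show "orthogonal_transformation ?f"
    by (simp add: orthogonal_transformation_def)
  have "a \<bullet> a = b \<bullet> b" using assms by (simp add: dot_square_norm)
  then have "2 * (a \<bullet> d) = d \<bullet> d"
    by (simp add: d_def inner_diff_left inner_diff_right inner_commute)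
  then show "?f a = b"
    by (cases "d = 0") (simp_all add: d_def)
  show "?f x = x" if "x \<bullet> (a - b) = 0" for x
    using that by (simp add: d_def)
qed

lemma orthonormal_map_orthogonal_transformation:
  assumes "orthogonal_transformation f" "orthonormal vs"
  shows "orthonormal (map f vs)"
  using assms(2) assms(1)
  by (induction vs) (auto simp: orthogonal_transformation_norm, auto simp: orthogonal_transformation_def)

text \<open>The tails are matched first, by \<open>f\<close>. The reflection taking
  \<open>f v\<close> to \<open>w\<close> then leaves the matched tail alone, since both vectors are
  orthogonal to it.\<close>

lemma orthonormal_lists_congruent:
  fixes vs ws :: "'a::real_inner list"
  assumes "length vs = length ws" "orthonormal vs" "orthonormal ws"
  obtains f where "orthogonal_transformation f" "map f vs = ws"
proof -
  have "\<exists>f. orthogonal_transformation f \<and> map f vs = ws"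
    using assms
  proof (induction vs ws rule: list_induct2)
    case Nil
    have "orthogonal_transformation (\<lambda>x. x :: 'a)" by simp
    then show ?case by (intro exI[of _ "\<lambda>x. x"]) simp
  next
    case (Cons v vs w ws)
    then obtain f where f: "orthogonal_transformation f" "map f vs = ws" by auto
    have on: "orthonormal (f v # ws)"
      using orthonormal_map_orthogonal_transformation[OF f(1) Cons.prems(1)] f(2) by simp
    then obtain g where g: "orthogonal_transformation g" "g (f v) = w"
        "\<And>x. x \<bullet> (f v - w) = 0 \<Longrightarrow> g x = x"
      using reflection_swapping[of "f v" w] Cons.prems by auto
    have "g x = x" if "x \<in> set ws" for x
      using that on Cons.prems(2) by (intro g(3)) (simp add: inner_diff_right inner_commute[of x])
    then have "map g ws = ws" by (simp add: map_idI)
    then have "map (g \<circ> f) (v # vs) = w # ws"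
      using f(2) g(2) by (metis list.simps(9) map_map comp_apply)
    then show ?case
      using orthogonal_transformation_compose[OF g(1) f(1)] by (intro exI[of _ "g \<circ> f"] conjI)
  qed
  then show ?thesis using that by blast
qed

text \<open>This is \<open>\<Phi>\<close>: up to a constant depending only on the dimension and the
  length of the list, the volume of the parallelepiped that the list spans.\<close>

definition ball_mixed :: "'a::euclidean_space list \<Rightarrow> real"
  where "ball_mixed vs = mixed_diff vs (cball 0 1)"

lemma ball_mixed_nonneg: "0 \<le> ball_mixed vs"
  by (simp add: ball_mixed_def mixed_diff_nonneg)

lemma ball_mixed_orthonormal:
  fixes vs ws :: "'a::euclidean_space list"
  assumes "length vs = length ws" "orthonormal vs" "orthonormal ws"
  shows "ball_mixed vs = ball_mixed ws"
proof -
  obtain f where f: "orthogonal_transformation f" "map f vs = ws"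
    using orthonormal_lists_congruent[OF assms] .
  have "f ` cball 0 1 = cball 0 1"
    using image_orthogonal_transformation_cball[OF f(1), of 0 1] f(1)
    by (simp add: linear_0 orthogonal_transformation_linear)
  then show ?thesis
    using mixed_diff_orthogonal_transformation[OF f(1), of "cball 0 1" vs] f(2)
    by (simp add: ball_mixed_def)
qed

lemma orthonormal_Basis_list:
  assumes "distinct bs" "set bs \<subseteq> (Basis :: 'a::euclidean_space set)"
  shows "orthonormal bs"
  using assms by (induction bs) (auto simp: inner_Basis)

text \<open>It suffices to treat basis vectors. A small box spanned by the remaining basis vectors
  fits into the unit ball, so monotonicity bounds the value below by the volume of a nondegenerate
  box.\<close>

lemma ball_mixed_orthonormal_pos:
  fixes us :: "'a::euclidean_space list"
  assumes us: "orthonormal us" and len: "length us \<le> DIM('a)"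
  shows "0 < ball_mixed us"
proof -
  obtain bs :: "'a list" where bs: "distinct bs" "set bs = Basis"
    using finite_distinct_list[OF finite_Basis] by blast
  have lenbs: "length bs = DIM('a)"
    using distinct_card[OF bs(1)] bs(2) by simp
  define k where "k = DIM('a) - length us"
  define vs where "vs = take k bs"
  define ws where "ws = drop k bs"
  \<comment> \<open>With edges of length 1/n, a sum of at most n segments along basis vectors stays
    in the unit ball by the triangle inequality.\<close>
  define e where "e = 1 / real DIM('a)"
  have e: "0 < e" by (simp add: e_def)
  have lenws: "length us = length ws"
    using len by (simp add: ws_def k_def lenbs)
  have set: "set vs \<subseteq> Basis" "set ws \<subseteq> Basis"
    using bs(2) by (auto simp: vs_def ws_def dest: in_set_takeD in_set_dropD)
  have ws: "orthonormal ws"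
    using bs set by (intro orthonormal_Basis_list) (auto simp: ws_def)
  have vs_bound: "seg_sum (map (\<lambda>b. e *\<^sub>R b) vs') \<subseteq> cball 0 (real (length vs') * e)"
    if "set vs' \<subseteq> Basis" for vs' :: "'a list"
    using that
  proof (induction vs')
    case (Cons v vs')
    have "seg (e *\<^sub>R v) \<subseteq> cball 0 e"
      using Cons.prems e by (auto simp: mem_seg mult_left_le_one_le)
    moreover have "cball 0 e + cball 0 (real (length vs') * e) \<subseteq> (cball 0 (real (length (v # vs')) * e) :: 'a set)"
      by (auto elim!: set_plus_elim simp: algebra_simps intro!: norm_triangle_mono)
    ultimately show ?case
      using Cons set_plus_mono2[of "seg (e *\<^sub>R v)" "cball 0 e"
        "seg_sum (map (\<lambda>b. e *\<^sub>R b) vs')" "cball 0 (real (length vs') * e)"]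
      by (metis (no_types, lifting) list.simps(9) order_trans seg_sum_Cons set_subset_Cons)
  qed simp
  have "length vs \<le> DIM('a)" by (simp add: vs_def lenbs)
  then have "real (length vs) * e \<le> 1" by (simp add: e_def)
  then have "seg_sum (map (\<lambda>b. e *\<^sub>R b) vs) \<subseteq> cball 0 1"
    using vs_bound[OF set(1)] by (meson order_trans subset_cball)
  then have "mixed_diff ws ({0} + seg_sum (map (\<lambda>b. e *\<^sub>R b) vs)) \<le> ball_mixed ws"
    unfolding ball_mixed_def by (intro mixed_diff_mono) auto
  moreover have "mixed_diff (map (\<lambda>b. e *\<^sub>R b) vs @ ws) {0} \<le> mixed_diff ws ({0} + seg_sum (map (\<lambda>b. e *\<^sub>R b) vs))"
    by (rule mixed_diff_append_le) simp
  moreover have "0 < mixed_diff (map (\<lambda>b. e *\<^sub>R b) vs @ ws) {0}"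
  proof -
    define s where "s b = (if b \<in> set vs then e else 1)" for b
    have disj: "set vs \<inter> set ws = {}"
      using bs(1) by (simp add: vs_def ws_def set_take_disj_set_drop_if_distinct)
    have "map (\<lambda>b. e *\<^sub>R b) vs @ ws = map (\<lambda>b. s b *\<^sub>R b) (vs @ ws)"
      using disj by (auto simp: s_def intro!: map_idI[symmetric])
    also have "vs @ ws = bs"
      by (simp add: vs_def ws_def)
    finally have "mixed_diff (map (\<lambda>b. e *\<^sub>R b) vs @ ws) {0} = (\<Prod>b\<leftarrow>bs. \<bar>s b\<bar>) * mixed_diff bs {0}"
      using mixed_diff_map_scaleR[of "{0}" s "\<lambda>x. x" bs] by simp
    moreover have "mixed_diff bs {0} = 1"
      using vol_linear_image_cbox[of "\<lambda>x. x" bs 0 One] bs by (simp add: linear_id[unfolded id_def])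
    moreover have "0 < (\<Prod>b\<leftarrow>bs. \<bar>s b\<bar>)"
      using e by (induction bs) (auto simp: s_def)
    ultimately show ?thesis by simp
  qed
  ultimately have "0 < ball_mixed ws" by linarith
  then show ?thesis
    using ball_mixed_orthonormal[OF lenws us ws] by simp
qed

section \<open>Gram--Schmidt orthogonalisation\<close>

lemma orthonormal_residual:
  assumes "orthonormal us" "u \<in> set us"
  shows "(x - (\<Sum>v\<leftarrow>us. (x \<bullet> v) *\<^sub>R v)) \<bullet> u = 0"
proof -
  have "(\<Sum>v\<leftarrow>us. (x \<bullet> v) *\<^sub>R v) \<bullet> u = x \<bullet> u"
    using assms
  proof (induction us)
    case (Cons a us)
    have 0: "a \<bullet> (\<Sum>v\<leftarrow>us. (x \<bullet> v) *\<^sub>R v) = 0"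
      using Cons.prems(1) by (induction us) (simp_all add: inner_add_right)
    show ?case
      using Cons 0 by (auto simp: inner_add_left dot_square_norm inner_commute[of _ a])
  qed simp
  then show ?thesis by (simp add: inner_diff_left)
qed

lemma sum_list_scaleR_in_span: "(\<Sum>v\<leftarrow>us. g v *\<^sub>R v) \<in> span (set us)"
proof (induction us)
  case (Cons u us)
  then show ?case
    using span_mono[of "set us" "set (u # us)"]
    by (auto intro!: span_add span_scale intro: span_base)
qed (simp add: span_zero)

lemma norm_orthonormal_residual:
  assumes "orthonormal us"
  shows "(norm (x - (\<Sum>v\<leftarrow>us. (x \<bullet> v) *\<^sub>R v)))\<^sup>2 = (norm x)\<^sup>2 - (\<Sum>v\<leftarrow>us. (x \<bullet> v)\<^sup>2)"
proof -
  let ?p = "\<Sum>v\<leftarrow>us. (x \<bullet> v) *\<^sub>R v"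
  \<comment> \<open>The projection \<open>?p\<close> is held fixed while the induction runs over an
    auxiliary list, later taken to be \<open>us\<close>.\<close>
  have "(x - ?p) \<bullet> (\<Sum>v\<leftarrow>vs. (x \<bullet> v) *\<^sub>R v) = 0" if "set vs \<subseteq> set us" for vs
    using that
    by (induction vs) (simp_all add: inner_add_right orthonormal_residual[OF assms])
  then have "(x - ?p) \<bullet> ?p = 0" by simp
  then have "(x - ?p) \<bullet> (x - ?p) = x \<bullet> x - x \<bullet> ?p"
    by (simp add: inner_diff_right inner_diff_left inner_commute)
  also have "x \<bullet> ?p = (\<Sum>v\<leftarrow>us. (x \<bullet> v)\<^sup>2)"
    by (induction us) (simp_all add: inner_add_right power2_eq_square)
  finally show ?thesis by (simp add: power2_norm_eq_inner)
qed

lemma mixed_diff_normalize: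
  assumes L: "convex_body L"
  shows "mixed_diff (v # vs) L = norm v * mixed_diff (v /\<^sub>R norm v # vs) L"
  using mixed_diff_scaleR[OF L, of "norm v" "v /\<^sub>R norm v" vs] by (cases "v = 0") auto

text \<open>Gram--Schmidt: \<open>r\<close> is the \<open>m\<close>-dimensional volume of the parallelepiped spanned by \<open>vs\<close>.\<close>

lemma mixed_diff_gram_schmidt:
  fixes vs :: "'a::euclidean_space list"
  shows "(\<forall>ps L. convex_body L \<longrightarrow> mixed_diff (ps @ vs) L = 0) \<or>
    (\<exists>us r. orthonormal us \<and> length us = length vs \<and> span (set us) = span (set vs) \<and>
      (\<forall>ps L. convex_body L \<longrightarrow> mixed_diff (ps @ vs) L = r * mixed_diff (ps @ us) L))"
proof (induction vs)
  case Nil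
  show ?case by (intro disjI2 exI[of _ "[]"] exI[of _ 1]) simp
next
  case (Cons v vs)
  show ?case
  proof (cases "\<forall>ps L. convex_body L \<longrightarrow> mixed_diff (ps @ vs) L = 0")
    case True
    have "mixed_diff (ps @ v # vs) L = 0" if "convex_body L" for ps L
      using True[rule_format, OF that, of "ps @ [v]"] by simp
    then show ?thesis by blast
  next
    case False
    then obtain us r where us: "orthonormal us" "length us = length vs" "span (set us) = span (set vs)"
      and r: "\<And>ps L. convex_body L \<Longrightarrow> mixed_diff (ps @ vs) L = r * mixed_diff (ps @ us) L"
      using Cons.IH by blast
    define p where "p = (\<Sum>u\<leftarrow>us. (v \<bullet> u) *\<^sub>R u)"
    define w where "w = v - p"
    define e where "e = w /\<^sub>R norm w"
    have p: "p \<in> span (set us)"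
      unfolding p_def by (rule sum_list_scaleR_in_span)
    have eq: "mixed_diff (ps @ v # vs) L = (r * norm w) * mixed_diff (ps @ e # us) L"
      if L: "convex_body L" for ps L
    proof -
      \<comment> \<open>The free prefix lets the induction hypothesis act behind \<open>v\<close>:
        it is used with \<open>v\<close> appended to \<open>ps\<close>.\<close>
      have "mixed_diff (ps @ v # vs) L = r * mixed_diff (ps @ v # us) L"
        using r[OF L, of "ps @ [v]"] by simp
      also have "mixed_diff (ps @ v # us) L = mixed_diff ((w + p) # ps @ us) L"
        by (simp add: mixed_diff_move w_def)
      also have "\<dots> = mixed_diff (w # ps @ us) L"
        using p span_mono[of "set us" "set (ps @ us)"]
        by (intro mixed_diff_shear_span[OF L]) auto
      also have "\<dots> = norm w * mixed_diff (e # ps @ us) L"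
        unfolding e_def by (rule mixed_diff_normalize[OF L])
      finally show ?thesis by (simp add: mixed_diff_move del: mixed_diff.simps)
    qed
    show ?thesis
    proof (cases "w = 0")
      \<comment> \<open>Here \<open>v\<close> lies in the span of \<open>vs\<close>: the factor
        \<open>norm w\<close> is zero and the first alternative holds.\<close>
      case True
      then show ?thesis using eq by simp
    next
      case False
      have "e \<bullet> u = 0" if "u \<in> set us" for u
        using orthonormal_residual[OF us(1) that, of v] by (simp add: e_def w_def p_def)
      then have "orthonormal (e # us)"
        using us(1) False by (simp add: e_def)
      moreover have "span (set (e # us)) = span (set (v # vs))"
      proof -
        have "span (insert v (set us)) = span (insert e (set us))"
        proof -
          have "e \<in> span (insert v (set us))"
            unfolding e_def w_def using p span_mono[of "set us" "insert v (set us)"]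
            by (auto intro!: span_scale span_diff intro: span_base)
          moreover have "v \<in> span (insert e (set us))"
          proof -
            have "v = norm w *\<^sub>R e + p" using False by (simp add: e_def w_def)
            then show ?thesis
              using p span_mono[of "set us" "insert e (set us)"]
              by (auto intro!: span_scale span_add intro: span_base)
          qed
          ultimately show ?thesis
            by (intro antisym span_minimal subspace_span) (auto intro: span_base)
        qed
        moreover have "span (insert v (set us)) = span (insert v (set vs))"
          using us(3) by (metis span_insert)
        ultimately show ?thesis by simp
      qed
      ultimately show ?thesis
        using eq us(2) by (intro disjI2 exI[of _ "e # us"] exI[of _ "r * norm w"]) simp
    qed
  qed
qed

lemma orthonormal_length_le:
  fixes us :: "'a::euclidean_space list"
  assumes "orthonormal us"
  shows "length us \<le> DIM('a)"
proof -
  have "pairwise orthogonal (set us)" "0 \<notin> set us" "distinct us"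
    using assms by (induction us) (auto simp: pairwise_insert orthogonal_def inner_commute)
  then have "independent (set us)"
    by (simp add: pairwise_orthogonal_independent)
  then have "card (set us) \<le> DIM('a)"
    using independent_bound by blast
  then show ?thesis using \<open>distinct us\<close> by (simp add: distinct_card)
qed

text \<open>No orthonormal list has more than n members, so Gram--Schmidt leaves only its vanishing
  alternative.\<close>

lemma mixed_diff_long:
  fixes vs :: "'a::euclidean_space list"
  assumes "convex_body L" "DIM('a) < length vs"
  shows "mixed_diff vs L = 0"
proof -
  have "mixed_diff ([] @ vs) L = 0"
    using mixed_diff_gram_schmidt[of vs] orthonormal_length_le assms
    by (metis not_le)
  then show ?thesis by simp
qed

section \<open>Projections and Steiner's formula for zonotopes\<close>

text \<open>Prepending a unit vector orthogonal to the list changes the value by a ratio that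
  depends only on dimension and length. Gram--Schmidt extracts the same factor \<open>r\<close> on
  both sides and reduces this to orthonormal lists; products replace the quotient.\<close>

lemma ball_mixed_Cons_orthogonal:
  fixes e b :: "'a::euclidean_space"
  assumes e: "norm e = 1" "\<And>w. w \<in> set ws \<Longrightarrow> e \<bullet> w = 0"
    and bs: "orthonormal (b # bs)" "length bs = length ws"
  shows "ball_mixed bs * ball_mixed (e # ws) = ball_mixed (b # bs) * ball_mixed ws"
  using mixed_diff_gram_schmidt[of ws]
proof (elim disjE exE conjE)
  assume "\<forall>ps L. convex_body L \<longrightarrow> mixed_diff (ps @ ws) L = 0"
  then have "mixed_diff ([e] @ ws) (cball 0 1) = 0" "mixed_diff ([] @ ws) (cball 0 1) = 0"
    using convex_body_cball by blast+
  then show ?thesis by (simp add: ball_mixed_def)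
next
  fix us r
  assume us: "orthonormal us" "length us = length ws" "span (set us) = span (set ws)"
    and r: "\<forall>ps L. convex_body L \<longrightarrow> mixed_diff (ps @ ws) L = r * mixed_diff (ps @ us) L"
  have "e \<bullet> u = 0" if "u \<in> set us" for u
  proof -
    have "u \<in> span (set ws)" using that us(3) span_base by blast
    then have "orthogonal e u"
      by (rule orthogonal_to_span) (simp add: e(2) orthogonal_def)
    then show ?thesis by (simp add: orthogonal_def)
  qed
  then have "orthonormal (e # us)" using us(1) e(1) by simp
  then have "ball_mixed (e # us) = ball_mixed (b # bs)" "ball_mixed us = ball_mixed bs"
    using bs us by (auto intro!: ball_mixed_orthonormal)
  moreover have "ball_mixed (e # ws) = r * ball_mixed (e # us)" "ball_mixed ws = r * ball_mixed us"
    using r[rule_format, of "cball 0 1" "[e]"] r[rule_format, of "cball 0 1" "[]"]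
    by (simp_all add: ball_mixed_def)
  ultimately show ?thesis by simp
qed

section \<open>Projections along a unit vector\<close>

definition drop_component :: "'a::real_inner \<Rightarrow> 'a \<Rightarrow> 'a"
  where "drop_component e x = x - (x \<bullet> e) *\<^sub>R e"

lemma linear_drop_component: "linear (drop_component e)"
  by (rule linearI) (simp_all add: drop_component_def inner_add_left algebra_simps)

lemma norm_drop_component_le:
  assumes "norm e = 1"
  shows "norm (drop_component e x) \<le> norm x"
proof -
  have "e \<bullet> e = 1" using assms by (simp add: dot_square_norm)
  then have "(norm (drop_component e x))\<^sup>2 = (norm x)\<^sup>2 - (x \<bullet> e)\<^sup>2"
    unfolding power2_norm_eq_inner drop_component_def
    by (simp add: inner_diff_left inner_diff_right inner_commute power2_eq_square)
  then show ?thesis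
    by (metis diff_le_eq le_add_same_cancel1 norm_ge_zero power2_le_imp_le zero_le_power2)
qed

text \<open>
  Adding the vector \<open>e\<close> to the list multiplies \<open>ball_mixed\<close> by the same constant whether one projects
  the list along \<open>e\<close> or \<open>e\<close> onto the complement of the list. Hence projecting the list along \<open>e\<close> multiplies
  \<open>ball_mixed\<close> by the distance from \<open>e\<close> to the span of the list.
\<close>

lemma sum_ball_mixed_drop_component:
  fixes vs :: "'a::euclidean_space list"
  assumes len: "length vs < DIM('a)"
  shows "(\<Sum>e\<in>Basis. (ball_mixed (map (drop_component e) vs))\<^sup>2) =
    (real DIM('a) - real (length vs)) * (ball_mixed vs)\<^sup>2"
proof -
  obtain Bs :: "'a list" where Bs: "distinct Bs" "set Bs = Basis"
    using finite_distinct_list[OF finite_Basis] by blast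
  have "length Bs = DIM('a)"
    using distinct_card[OF Bs(1)] Bs(2) by simp
  then have "length (take (Suc (length vs)) Bs) = Suc (length vs)"
    using len by (simp add: Suc_le_eq)
  then obtain b bs where b_bs: "take (Suc (length vs)) Bs = b # bs" and bs: "length bs = length vs"
    by (metis length_Suc_conv)
  have on: "orthonormal (b # bs)"
    unfolding b_bs[symmetric] using Bs
    by (intro orthonormal_Basis_list) (auto dest: in_set_takeD)
  \<comment> \<open>The values on orthonormal lists of lengths m and m + 1, where m is the length of
    \<open>vs\<close>; by orthogonal invariance the choice of list does not matter.\<close>
  let ?c = "ball_mixed bs" and ?d = "ball_mixed (b # bs)"
  have d: "0 < ?d"
    using ball_mixed_orthonormal_pos[OF on] len bs by simp
  have key: "?d * ball_mixed (map (drop_component e) vs) = ?c * ball_mixed (e # vs)" if "e \<in> Basis" for e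
  proof -
    have "?c * ball_mixed (e # map (drop_component e) vs) = ?d * ball_mixed (map (drop_component e) vs)"
      using on bs that
      by (intro ball_mixed_Cons_orthogonal)
        (auto simp: drop_component_def inner_diff_right inner_Basis inner_commute)
    \<comment> \<open>Projecting along \<open>e\<close> is a shear parallel to \<open>e\<close>,
      which the leading \<open>e\<close> absorbs.\<close>
    moreover have "ball_mixed (e # map (drop_component e) vs) = ball_mixed (e # vs)"
      using mixed_diff_map_shear[of "cball 0 1" e "\<lambda>x. - (x \<bullet> e)" vs]
      by (simp add: ball_mixed_def drop_component_def[abs_def])
    ultimately show ?thesis by simp
  qed
  show ?thesis
    using mixed_diff_gram_schmidt[of vs]
  proof (elim disjE exE conjE)
    assume 0: "\<forall>ps L. convex_body L \<longrightarrow> mixed_diff (ps @ vs) L = 0"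
    have "ball_mixed (e # vs) = 0" for e
      using 0[rule_format, of "cball 0 1" "[e]"] by (simp add: ball_mixed_def)
    moreover have "ball_mixed vs = 0"
      using 0[rule_format, of "cball 0 1" "[]"] by (simp add: ball_mixed_def)
    ultimately show ?thesis using key d by simp
  next
    fix us r
    assume us: "orthonormal us" "length us = length vs" "span (set us) = span (set vs)"
      and r: "\<forall>ps L. convex_body L \<longrightarrow> mixed_diff (ps @ vs) L = r * mixed_diff (ps @ us) L"
    have \<Phi>us: "ball_mixed us = ?c"
      using ball_mixed_orthonormal us bs on by (metis orthonormal.simps(2))
    have \<Phi>vs: "ball_mixed vs = r * ?c"
      using r[rule_format, of "cball 0 1" "[]"] \<Phi>us by (simp add: ball_mixed_def)
    \<comment> \<open>The part of \<open>e\<close> orthogonal to the span of \<open>vs\<close>; its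
      norm is the distance from \<open>e\<close> to that span.\<close>
    define w where "w e = e - (\<Sum>u\<leftarrow>us. (e \<bullet> u) *\<^sub>R u)" for e
    have proj: "ball_mixed (map (drop_component e) vs) = norm (w e) * ball_mixed vs" if "e \<in> Basis" for e
    proof -
      have "ball_mixed (e # vs) = r * ball_mixed (e # us)"
        using r[rule_format, of "cball 0 1" "[e]"] by (simp add: ball_mixed_def)
      also have "ball_mixed (e # us) = ball_mixed (w e # us)"
        using mixed_diff_shear_span[OF convex_body_cball[of 0 1] sum_list_scaleR_in_span[of "(\<bullet>) e" us], of "w e"]
        by (simp add: ball_mixed_def w_def del: mixed_diff.simps)
      also have "\<dots> = norm (w e) * ball_mixed (w e /\<^sub>R norm (w e) # us)"
        unfolding ball_mixed_def by (rule mixed_diff_normalize) simp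
      also have "\<dots> = norm (w e) * ?d"
      proof (cases "w e = 0")
        case False
        have "w e \<bullet> u = 0" if "u \<in> set us" for u
          unfolding w_def by (rule orthonormal_residual[OF us(1) that])
        then have "orthonormal (w e /\<^sub>R norm (w e) # us)"
          using us(1) False by simp
        then show ?thesis
          using ball_mixed_orthonormal[OF _ _ on, of "w e /\<^sub>R norm (w e) # us"] us bs by simp
      qed simp
      finally have "?d * ball_mixed (map (drop_component e) vs) = ?d * (norm (w e) * ball_mixed vs)"
        using key[OF that] \<Phi>vs by (simp add: mult_ac)
      then show ?thesis using d by simp
    qed
    \<comment> \<open>By Pythagoras each basis vector contributes 1 minus its squared coordinates
      along \<open>us\<close>; summed over the basis, every unit vector \<open>u\<close> removes
      exactly 1.\<close>
    have "(\<Sum>e\<in>Basis. (norm (w e))\<^sup>2) = (\<Sum>e\<in>Basis. 1 - (\<Sum>u\<leftarrow>us. (e \<bullet> u)\<^sup>2))"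
      unfolding w_def norm_orthonormal_residual[OF us(1)] by simp
    also have "\<dots> = real DIM('a) - (\<Sum>e\<in>Basis. \<Sum>u\<leftarrow>us. (e \<bullet> u)\<^sup>2)"
      by (simp add: sum_subtractf)
    also have "(\<Sum>e\<in>Basis. \<Sum>u\<leftarrow>us. (e \<bullet> u)\<^sup>2) = real (length us)"
      using us(1)
    proof (induction us)
      case (Cons u us)
      have "(\<Sum>e\<in>Basis. (e \<bullet> u)\<^sup>2) = 1"
        using Cons.prems euclidean_inner[of u u]
        by (simp add: dot_square_norm power2_eq_square inner_commute)
      then show ?case using Cons by (simp add: sum.distrib)
    qed simp
    finally have "(\<Sum>e\<in>Basis. (norm (w e))\<^sup>2) = real DIM('a) - real (length vs)"
      using us(2) by simp
    then show ?thesis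
      using proj by (simp add: power_mult_distrib flip: sum_distrib_right)
  qed
qed

section \<open>The triangle inequality over several lists of vectors\<close>

lemma norm_sum_list_le: "norm (\<Sum>x\<leftarrow>xs. g x) \<le> (\<Sum>x\<leftarrow>xs. norm (g x :: 'a::real_normed_vector))"
  by (induction xs) (auto intro: norm_triangle_le)

lemma sum_ball_mixed_drop_component_minkowski:
  fixes X :: "'a::euclidean_space list list"
  assumes m: "m < DIM('a)" and X: "\<And>us. us \<in> set X \<Longrightarrow> length us = m"
  shows "(\<Sum>e\<in>Basis. (\<Sum>us\<leftarrow>X. ball_mixed (map (drop_component e) us))\<^sup>2) \<le>
    (real DIM('a) - real m) * (\<Sum>us\<leftarrow>X. ball_mixed us)\<^sup>2"
proof -
  have norm_comb: "(norm (\<Sum>e\<in>Basis. g e *\<^sub>R e))\<^sup>2 = (\<Sum>e\<in>Basis. (g e)\<^sup>2)" for g :: "'a \<Rightarrow> real"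
  proof -
    have "(norm x)\<^sup>2 = (\<Sum>e\<in>Basis. (x \<bullet> e)\<^sup>2)" for x :: 'a
      unfolding power2_norm_eq_inner using euclidean_inner[of x x] by (simp add: power2_eq_square)
    then show ?thesis by simp
  qed
  \<comment> \<open>\<open>y us\<close> gathers the n projected values into one vector. By
    \<open>sum_ball_mixed_drop_component\<close> its length is \<open>q * ball_mixed us\<close>, so
    the triangle inequality for the sum of all \<open>y us\<close> is the claim.\<close>
  define y :: "'a list \<Rightarrow> 'a" where "y us = (\<Sum>e\<in>Basis. ball_mixed (map (drop_component e) us) *\<^sub>R e)" for us
  define q where "q = sqrt (real DIM('a) - real m)"
  have norm_y: "norm (y us) = q * ball_mixed us" if "us \<in> set X" for us
  proof -
    have "(norm (y us))\<^sup>2 = (real DIM('a) - real m) * (ball_mixed us)\<^sup>2"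
      unfolding y_def norm_comb using sum_ball_mixed_drop_component[of us] X[OF that] m by simp
    also have "\<dots> = (q * ball_mixed us)\<^sup>2"
      using m by (simp add: q_def power_mult_distrib)
    finally have "(norm (y us))\<^sup>2 = (q * ball_mixed us)\<^sup>2" .
    moreover have "0 \<le> q * ball_mixed us"
      using m by (simp add: q_def ball_mixed_nonneg)
    ultimately show ?thesis
      using norm_ge_zero power2_eq_imp_eq by blast
  qed
  have sum_y: "(\<Sum>us\<leftarrow>X. y us) = (\<Sum>e\<in>Basis. (\<Sum>us\<leftarrow>X. ball_mixed (map (drop_component e) us)) *\<^sub>R e)"
    by (induction X) (simp_all add: y_def sum.distrib scaleR_left_distrib)
  have "norm (\<Sum>us\<leftarrow>X. y us) \<le> (\<Sum>us\<leftarrow>X. norm (y us))"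
    by (rule norm_sum_list_le)
  also have "\<dots> = (\<Sum>us\<leftarrow>X. q * ball_mixed us)"
    using norm_y by (intro arg_cong[where f = sum_list] map_cong) auto
  also have "\<dots> = q * (\<Sum>us\<leftarrow>X. ball_mixed us)"
    by (simp add: sum_list_const_mult)
  finally have "(norm (\<Sum>us\<leftarrow>X. y us))\<^sup>2 \<le> (q * (\<Sum>us\<leftarrow>X. ball_mixed us))\<^sup>2"
    by (intro power_mono) auto
  then show ?thesis
    unfolding sum_y norm_comb using m by (simp add: q_def power_mult_distrib)
qed

text \<open>For \<open>m\<close> at most n this is the coefficient of t^(n-m) in the Steiner
  polynomial of \<open>seg_sum vs\<close>, that is, \<kappa>_(n-m) times its intrinsic volume of
  index \<open>m\<close>. Sublists count with multiplicity, as generators may repeat.\<close>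

definition ball_mixed_sum :: "nat \<Rightarrow> 'a::euclidean_space list \<Rightarrow> real"
  where "ball_mixed_sum m vs = (\<Sum>us\<leftarrow>[us \<leftarrow> subseqs vs. length us = m]. ball_mixed us)"

lemma subseqs_map: "subseqs (map f xs) = map (map f) (subseqs xs)"
  by (induction xs) (simp_all add: Let_def)

lemma sum_ball_mixed_sum_drop_component:
  fixes vs :: "'a::euclidean_space list"
  assumes "m < DIM('a)"
  shows "(\<Sum>e\<in>Basis. (ball_mixed_sum m (map (drop_component e) vs))\<^sup>2) \<le>
    (real DIM('a) - real m) * (ball_mixed_sum m vs)\<^sup>2"
  using sum_ball_mixed_drop_component_minkowski[OF assms, of "[us \<leftarrow> subseqs vs. length us = m]"]
  by (simp add: ball_mixed_sum_def subseqs_map filter_map o_def)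

text \<open>Scaling space by \<open>t\<close> turns the unit ball into \<open>cball 0 t\<close> and
  multiplies volumes by t^n; scaling the vectors back costs one factor 1/t each.\<close>

lemma mixed_diff_cball:
  fixes us :: "'a::euclidean_space list"
  assumes t: "0 < t"
  shows "mixed_diff us (cball 0 t) = t ^ (DIM('a) - length us) * ball_mixed us"
proof (cases "length us \<le> DIM('a)")
  case True
  have scale: "vol ((\<lambda>x. t *\<^sub>R x) ` L) = t ^ DIM('a) * vol L" for L :: "'a set"
    using measure_lebesgue_affine[of t 0 L] t by simp
  have "mixed_diff us (cball 0 t) = mixed_diff (map ((*\<^sub>R) t) (map (\<lambda>x. (1 / t) *\<^sub>R x) us)) ((*\<^sub>R) t ` cball 0 1)"
    using t cball_scale[of t "0 :: 'a" 1] by (simp add: o_def)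
  also have "\<dots> = t ^ DIM('a) * mixed_diff (map (\<lambda>x. (1 / t) *\<^sub>R x) us) (cball 0 1)"
    using scale by (intro mixed_diff_linear_image linear_scale_self) simp_all
  also have "mixed_diff (map (\<lambda>x. (1 / t) *\<^sub>R x) us) (cball 0 1) = (1 / t) ^ length us * ball_mixed us"
    using mixed_diff_map_scaleR[OF convex_body_cball, of "\<lambda>_. 1 / t" "\<lambda>x. x" us 0 1] t
    by (simp add: ball_mixed_def map_replicate_const)
  also have "t ^ DIM('a) * ((1 / t) ^ length us * ball_mixed us) = t ^ (DIM('a) - length us) * ball_mixed us"
    using t True by (simp add: power_diff power_one_over field_simps)
  finally show ?thesis .
next
  \<comment> \<open>The truncated exponent is 0 here, and both sides vanish.\<close>
  case False
  then show ?thesis by (simp add: ball_mixed_def mixed_diff_long)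
qed

lemma sum_list_by_length:
  fixes g :: "'b list \<Rightarrow> 'a::comm_monoid_add"
  assumes "\<And>us. n < length us \<Longrightarrow> g us = 0"
  shows "(\<Sum>us\<leftarrow>X. g us) = (\<Sum>i\<le>n. \<Sum>us\<leftarrow>[us \<leftarrow> X. length us = i]. g us)"
proof (induction X)
  case (Cons a X)
  have "(\<Sum>us\<leftarrow>[us \<leftarrow> a # X. length us = i]. g us) =
      (if i = length a then g a else 0) + (\<Sum>us\<leftarrow>[us \<leftarrow> X. length us = i]. g us)" for i
    by simp
  then have "(\<Sum>i\<le>n. \<Sum>us\<leftarrow>[us \<leftarrow> a # X. length us = i]. g us) =
      (\<Sum>i\<le>n. if i = length a then g a else 0) + (\<Sum>us\<leftarrow>X. g us)"
    by (simp only: sum.distrib Cons)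
  also have "(\<Sum>i\<le>n. if i = length a then g a else 0) = g a"
    using assms[of a] by (simp add: not_le)
  finally show ?case by simp
qed simp

text \<open>The ball serves as the initial body and the segments are added to it; grouping the
  sublists by length collects equal powers of \<open>t\<close>. This is the Steiner polynomial of a
  zonotope.\<close>

lemma vol_singleton_plus_seg_sum_plus_cball:
  fixes vs :: "'a::euclidean_space list"
  assumes t: "0 < t"
  shows "vol ({a} + seg_sum vs + cball 0 t) = (\<Sum>i\<le>DIM('a). ball_mixed_sum i vs * t ^ (DIM('a) - i))"
proof -
  have "vol ({a} + seg_sum vs + cball 0 t) = vol (cball 0 t + seg_sum vs)"
    by (simp add: vol_singleton_plus add.assoc add.commute[of "cball 0 t"])
  also have "\<dots> = (\<Sum>us\<leftarrow>subseqs vs. mixed_diff us (cball 0 t))"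
    by (rule vol_plus_seg_sum)
  also have "\<dots> = (\<Sum>us\<leftarrow>subseqs vs. ball_mixed us * t ^ (DIM('a) - length us))"
    using t by (simp add: mixed_diff_cball mult.commute)
  also have "\<dots> = (\<Sum>i\<le>DIM('a). \<Sum>us\<leftarrow>[us \<leftarrow> subseqs vs. length us = i]. ball_mixed us * t ^ (DIM('a) - length us))"
    by (rule sum_list_by_length) (simp add: ball_mixed_def mixed_diff_long)
  also have "\<dots> = (\<Sum>i\<le>DIM('a). ball_mixed_sum i vs * t ^ (DIM('a) - i))"
  proof (rule sum.cong)
    fix i
    have "(\<Sum>us\<leftarrow>[us \<leftarrow> X. length us = i]. ball_mixed us * t ^ (DIM('a) - length us)) =
        (\<Sum>us\<leftarrow>[us \<leftarrow> X. length us = i]. ball_mixed us) * t ^ (DIM('a) - i)" for X :: "'a list list"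
      by (induction X) (auto simp: distrib_right)
    then show "(\<Sum>us\<leftarrow>[us \<leftarrow> subseqs vs. length us = i]. ball_mixed us * t ^ (DIM('a) - length us)) =
        ball_mixed_sum i vs * t ^ (DIM('a) - i)"
      by (simp add: ball_mixed_sum_def)
  qed simp
  finally show ?thesis .
qed

section \<open>Passage to the limit\<close>

lemma scaleR_image_cball: "0 \<le> t \<Longrightarrow> (\<lambda>x. t *\<^sub>R x) ` cball 0 1 = cball (0 :: 'a::euclidean_space) t"
  using cball_scale[of t "0 :: 'a" 1] by (cases "t = 0") (auto simp: image_constant_conv)

lemma plus_cball_eq_infdist:
  fixes K :: "'a::euclidean_space set"
  assumes K: "compact K" "K \<noteq> {}" and t: "0 \<le> t"
  shows "K + cball 0 t = {x. infdist x K \<le> t}"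
proof (intro set_eqI iffI)
  fix x assume "x \<in> K + cball 0 t"
  then obtain a b where "a \<in> K" "b \<in> cball 0 t" "x = a + b" by (rule set_plus_elim)
  then show "x \<in> {x. infdist x K \<le> t}"
    using infdist_le2[of a K x t] by (simp add: dist_norm)
next
  fix x assume x: "x \<in> {x. infdist x K \<le> t}"
  obtain a where a: "a \<in> K" "infdist x K = dist x a"
    using infdist_attains_inf[of K x] K compact_imp_closed by blast
  then have "x - a \<in> cball 0 t" using x by (simp add: dist_norm norm_minus_commute)
  then have "a + (x - a) \<in> K + cball 0 t" using a(1) by (rule set_plus_intro[rotated])
  then show "x \<in> K + cball 0 t" by simp
qed

lemma plus_cball_subset:
  fixes A B :: "'a::euclidean_space set"
  assumes A: "compact A" "A \<noteq> {}" and B: "compact B" "B \<noteq> {}"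
    and h: "\<And>a. a \<in> A \<Longrightarrow> infdist a B \<le> h" and "0 \<le> s" "0 \<le> h"
  shows "A + cball 0 s \<subseteq> B + cball 0 (s + h)"
proof
  fix x assume "x \<in> A + cball 0 s"
  then obtain a b where "a \<in> A" "b \<in> cball 0 s" "x = a + b" by (rule set_plus_elim)
  then have "infdist x B \<le> s + h"
    using infdist_triangle[of x B a] h[of a] by (simp add: dist_norm)
  then show "x \<in> B + cball 0 (s + h)"
    using plus_cball_eq_infdist[OF B, of "s + h"] assms by simp
qed

text \<open>After a translation \<open>K\<close> contains the origin, and contraction by s/t then
  maps K + tB into K + sB. This controls how the volume depends on the radius.\<close>

lemma vol_plus_cball_scale:
  fixes K :: "'a::euclidean_space set"
  assumes K: "convex_body K" "K \<noteq> {}" and st: "0 < s" "s \<le> t"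
  shows "(s / t) ^ DIM('a) * vol (K + cball 0 t) \<le> vol (K + cball 0 s)"
proof -
  obtain a where a: "a \<in> K" using K by blast
  define L where "L = {- a} + K"
  have L: "convex_body L" unfolding L_def by (intro convex_body_plus) (auto simp: K)
  have L0: "0 \<in> L" using set_plus_intro[of "- a" "{- a}" a K] a by (simp add: L_def)
  have vol: "vol (L + cball 0 r) = vol (K + cball 0 r)" for r
    by (simp add: L_def add.assoc vol_singleton_plus)
  define u where "u = s / t"
  have u: "0 < u" "u \<le> 1" "u * t = s" using st by (simp_all add: u_def)
  have "(\<lambda>x. u *\<^sub>R x) ` (L + cball 0 t) \<subseteq> L + cball 0 s"
  proof
    fix y assume "y \<in> (\<lambda>x. u *\<^sub>R x) ` (L + cball 0 t)"
    then obtain x b where xb: "x \<in> L" "b \<in> cball 0 t" "y = u *\<^sub>R (x + b)"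
      by (auto elim!: set_plus_elim)
    have "u *\<^sub>R x + (1 - u) *\<^sub>R 0 \<in> L"
      using L L0 xb(1) u by (intro convexD) (auto simp: convex_body_def)
    moreover have "u * norm b \<le> u * t"
      using xb(2) u by (intro mult_left_mono) auto
    then have "u *\<^sub>R b \<in> cball 0 s"
      using u by simp
    ultimately have "u *\<^sub>R x + u *\<^sub>R b \<in> L + cball 0 s"
      by (intro set_plus_intro) simp_all
    then show "y \<in> L + cball 0 s"
      using xb(3) by (simp add: scaleR_right_distrib)
  qed
  moreover have "convex_body ((\<lambda>x. u *\<^sub>R x) ` (L + cball 0 t))"
    using convex_body_plus[OF L convex_body_cball, of 0 t]
    by (simp add: convex_body_def compact_scaling convex_scaling)
  ultimately have "vol ((\<lambda>x. u *\<^sub>R x) ` (L + cball 0 t)) \<le> vol (L + cball 0 s)"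
    by (intro vol_mono) (simp_all add: convex_body_plus L)
  moreover have "vol ((\<lambda>x. u *\<^sub>R x) ` (L + cball 0 t)) = u ^ DIM('a) * vol (L + cball 0 t)"
    using measure_lebesgue_affine[of u 0 "L + cball 0 t"] u by simp
  ultimately show ?thesis by (simp add: vol u_def)
qed

text \<open>Pointwise bounds on distances replace the suprema, so that the notion passes directly to
  images under 1-Lipschitz maps.\<close>

definition hausdorff_limit :: "(nat \<Rightarrow> 'a::metric_space set) \<Rightarrow> 'a set \<Rightarrow> bool"
  where "hausdorff_limit Z K \<longleftrightarrow> (\<exists>h. h \<longlonglongrightarrow> 0 \<and>
    (\<forall>k. (\<forall>a\<in>Z k. infdist a K \<le> h k) \<and> (\<forall>b\<in>K. infdist b (Z k) \<le> h k)))"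

text \<open>Z_k + tB lies inside K + (t + h_k)B and, once h_k < t, contains K + (t - h_k)B. By
  \<open>vol_plus_cball_scale\<close> both volumes compare with that of K + tB up to factors tending
  to 1.\<close>

lemma vol_plus_cball_limit:
  fixes K :: "'a::euclidean_space set"
  assumes K: "convex_body K" "K \<noteq> {}" and Z: "\<And>k. convex_body (Z k)" "\<And>k. Z k \<noteq> {}"
    and lim: "hausdorff_limit Z K" and t: "0 < t"
  shows "(\<lambda>k. vol (Z k + cball 0 t)) \<longlonglongrightarrow> vol (K + cball 0 t)"
proof -
  obtain h where h: "h \<longlonglongrightarrow> 0" "\<And>k a. a \<in> Z k \<Longrightarrow> infdist a K \<le> h k" "\<And>k b. b \<in> K \<Longrightarrow> infdist b (Z k) \<le> h k"
    using lim by (auto simp: hausdorff_limit_def)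
  have h0: "0 \<le> h k" for k
    using h(2)[of _ k] Z(2)[of k] infdist_nonneg by (meson all_not_in_conv order_trans)
  let ?V = "vol (K + cball 0 t)"
  have comp: "compact K" "compact (Z k)" for k
    using K(1) Z(1) by (simp_all add: convex_body_def)
  have body: "convex_body (K + cball 0 s)" "convex_body (Z k + cball 0 s)" for s k
    by (simp_all add: convex_body_plus K Z)
  have upper: "vol (Z k + cball 0 t) \<le> ((t + h k) / t) ^ DIM('a) * ?V" for k
  proof -
    have "vol (Z k + cball 0 t) \<le> vol (K + cball 0 (t + h k))"
      using t h0 h(2) K Z(2) by (intro vol_mono body plus_cball_subset comp) auto
    moreover have "(t / (t + h k)) ^ DIM('a) * vol (K + cball 0 (t + h k)) \<le> ?V"
      using t h0[of k] by (intro vol_plus_cball_scale K) auto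
    then have "vol (K + cball 0 (t + h k)) \<le> ((t + h k) / t) ^ DIM('a) * ?V"
      using t h0[of k] by (simp add: power_divide field_simps)
    ultimately show ?thesis by linarith
  qed
  have lower: "((t - h k) / t) ^ DIM('a) * ?V \<le> vol (Z k + cball 0 t)" if "h k < t" for k
  proof -
    have "((t - h k) / t) ^ DIM('a) * ?V \<le> vol (K + cball 0 (t - h k))"
      using that h0[of k] by (intro vol_plus_cball_scale K) auto
    also have "K + cball 0 (t - h k) \<subseteq> Z k + cball 0 (t - h k + h k)"
      using that h0 h(3) K Z(2) by (intro plus_cball_subset comp) auto
    then have "vol (K + cball 0 (t - h k)) \<le> vol (Z k + cball 0 t)"
      by (intro vol_mono body) simp
    finally show ?thesis .
  qed
  have "(\<lambda>k. ((t - h k) / t) ^ DIM('a) * ?V) \<longlonglongrightarrow> ((t - 0) / t) ^ DIM('a) * ?V"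
    "(\<lambda>k. ((t + h k) / t) ^ DIM('a) * ?V) \<longlonglongrightarrow> ((t + 0) / t) ^ DIM('a) * ?V"
    using t by (intro tendsto_intros h(1); simp)+
  then have lims: "(\<lambda>k. ((t - h k) / t) ^ DIM('a) * ?V) \<longlonglongrightarrow> ?V"
    "(\<lambda>k. ((t + h k) / t) ^ DIM('a) * ?V) \<longlonglongrightarrow> ?V"
    using t by simp_all
  have "eventually (\<lambda>k. h k < t) sequentially"
    using h(1) t by (rule order_tendstoD)
  then show ?thesis
    using lower upper
    by (intro tendsto_sandwich[OF _ _ lims]) (auto elim: eventually_mono)
qed

text \<open>A compact set is the intersection of its decreasing parallel bodies. This supplies the
  value t = 0 in the Steiner formula.\<close>

lemma vol_plus_cball_right_continuous_at_0:
  fixes K :: "'a::euclidean_space set"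
  assumes K: "convex_body K" "K \<noteq> {}"
  shows "(\<lambda>k. vol (K + cball 0 (1 / real (Suc k)))) \<longlonglongrightarrow> vol K"
proof -
  let ?A = "\<lambda>k. K + cball 0 (1 / real (Suc k))"
  have K': "compact K" using K(1) by (simp add: convex_body_def)
  have A: "?A k = {x. infdist x K \<le> 1 / real (Suc k)}" for k
    by (rule plus_cball_eq_infdist[OF K' K(2)]) simp
  have m: "?A k \<in> lmeasurable" for k
    by (simp add: convex_body_lmeasurable convex_body_plus K)
  have "(\<lambda>k. vol (?A k)) \<longlonglongrightarrow> vol (\<Inter>k. ?A k)"
  proof (rule Lim_measure_decseq)
    show "range ?A \<subseteq> sets lebesgue" using m by auto
    show "decseq ?A"
    proof (rule decseq_SucI)
      show "?A (Suc k) \<subseteq> ?A k" for k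
        unfolding A by (auto intro: order_trans simp: frac_le)
    qed
    show "emeasure lebesgue (?A k) \<noteq> \<infinity>" for k
      using fmeasurableD2[OF m] unfolding infinity_ennreal_def .
  qed
  also have "(\<Inter>k. ?A k) = K"
  proof (intro equalityI subsetI)
    fix x assume "x \<in> (\<Inter>k. ?A k)"
    then have "infdist x K \<le> 1 / real (Suc k)" for k
      unfolding A by auto
    then have "infdist x K \<le> 0"
      by (intro LIMSEQ_le_const[OF LIMSEQ_Suc[OF lim_1_over_n]]) auto
    then show "x \<in> K"
      using in_closed_iff_infdist_zero[of K x] K(2) K' compact_imp_closed infdist_nonneg[of x K]
      by auto
  next
    fix x assume "x \<in> K"
    then show "x \<in> (\<Inter>k. ?A k)" unfolding A by simp
  qed
  finally show ?thesis .
qed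

text \<open>Lagrange interpolation at the nodes 1, ..., n + 1. The nodes are positive because
  \<open>vol_plus_cball_limit\<close> concerns positive radii.\<close>

lemma coeffs_by_interpolation:
  "\<exists>c :: nat \<Rightarrow> nat \<Rightarrow> real. \<forall>a. \<forall>j\<le>n. a j = (\<Sum>l\<le>n. c j l * (\<Sum>i\<le>n. a i * real (Suc l) ^ i))"
proof -
  \<comment> \<open>The Lagrange basis polynomial that is 1 at the node l + 1 and 0 at the other
    nodes.\<close>
  define q :: "nat \<Rightarrow> real poly"
    where "q l = (\<Prod>m\<in>{..n} - {l}. smult (1 / (real (Suc l) - real (Suc m))) [:- real (Suc m), 1:])" for l
  have deg_q: "degree (q l) \<le> n" if "l \<le> n" for l
  proof -
    have "degree (q l) \<le> (\<Sum>m\<in>{..n} - {l}. degree (smult (1 / (real (Suc l) - real (Suc m))) [:- real (Suc m), 1:]))"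
      unfolding q_def by (rule order_trans[OF degree_prod_sum_le]) (simp_all only: o_def finite_Diff finite_atMost order_refl)
    also have "\<dots> \<le> (\<Sum>m\<in>{..n} - {l}. 1)"
      by (intro sum_mono) simp
    also have "\<dots> = n" using that by simp
    finally show ?thesis .
  qed
  have poly_q: "poly (q l) (real (Suc k)) = (if k = l then 1 else 0)" if "l \<le> n" "k \<le> n" for k l
  proof (cases "k = l")
    case True
    have "poly (smult (1 / (real (Suc l) - real (Suc m))) [:- real (Suc m), 1:]) (real (Suc l)) = 1"
      if "m \<noteq> l" for m
      using that by (simp add: divide_simps)
    then show ?thesis unfolding q_def poly_prod using True by (auto intro!: prod.neutral)
  next
    case False
    then show ?thesis unfolding q_def poly_prod using that
      by (auto intro!: prod_zero bexI[of _ k] simp flip: add_divide_distrib)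
  qed
  have "a j = (\<Sum>l\<le>n. coeff (q l) j * (\<Sum>i\<le>n. a i * real (Suc l) ^ i))" if "j \<le> n" for a :: "nat \<Rightarrow> real" and j
  proof -
    define p where "p = (\<Sum>i\<le>n. monom (a i) i)"
    have poly_p: "poly p x = (\<Sum>i\<le>n. a i * x ^ i)" for x
      by (simp add: p_def poly_sum poly_monom)
    have deg_p: "degree p \<le> n"
      unfolding p_def by (intro degree_sum_le) (auto intro: order_trans[OF degree_monom_le])
    \<comment> \<open>Both sides have degree at most n and agree at n + 1 nodes.\<close>
    have "p = (\<Sum>l\<le>n. smult (poly p (real (Suc l))) (q l))"
    proof (rule poly_eqI_degree)
      let ?A = "(\<lambda>k. real (Suc k)) ` {..n}"
      have "card ?A = Suc n"
        by (subst card_image) (auto simp: inj_on_def)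
      then show "degree p < card ?A"
        and "degree (\<Sum>l\<le>n. smult (poly p (real (Suc l))) (q l)) < card ?A"
        using deg_p deg_q
        by (auto simp: less_Suc_eq_le intro!: degree_sum_le order_trans[OF degree_smult_le])
      fix x assume "x \<in> ?A"
      then obtain k where k: "k \<le> n" "x = real (Suc k)" by blast
      have "poly (\<Sum>l\<le>n. smult (poly p (real (Suc l))) (q l)) x =
          (\<Sum>l\<le>n. if k = l then poly p (real (Suc l)) else 0)"
        unfolding poly_sum k(2) by (intro sum.cong) (use k(1) poly_q in auto)
      then show "poly p x = poly (\<Sum>l\<le>n. smult (poly p (real (Suc l))) (q l)) x"
        using k by simp
    qed
    then have "coeff p j = (\<Sum>l\<le>n. coeff (q l) j * poly p (real (Suc l)))"
      by (metis (no_types, lifting) coeff_sum coeff_smult mult.commute sum.cong)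
    moreover have "coeff p j = a j"
      using that by (simp add: p_def coeff_sum coeff_monom)
    ultimately show ?thesis by (simp add: poly_p)
  qed
  then show ?thesis by (intro exI[of _ "\<lambda>j l. coeff (q l) j"]) blast
qed

section \<open>Steiner coefficients of a limit body\<close>

lemma unit_ball_vol_neq_0: "unit_ball_vol (real k) \<noteq> 0"
  using unit_ball_vol_pos[of "real k"] by linarith

lemma sum_reverse: "(\<Sum>i=0..(n::nat). f (n - i) :: real) = (\<Sum>i\<le>n. f i)"
  unfolding atLeast0AtMost
  by (rule sum.reindex_bij_witness[of _ "\<lambda>k. n - k" "\<lambda>k. n - k"]) auto

text \<open>The expansion for positive \<open>t\<close> extends to t = 0 by continuity of both
  sides. The index is reversed and the ball volumes are divided out to match
  \<open>steiner_coeffs\<close>.\<close>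

lemma steiner_coeffsI:
  fixes K :: "'a::euclidean_space set"
  assumes K: "convex_body K" "K \<noteq> {}"
    and vol: "\<And>t. 0 < t \<Longrightarrow> vol (K + cball 0 t) = (\<Sum>j\<le>DIM('a). a j * t ^ j)"
  shows "steiner_coeffs K (\<lambda>i. if i \<le> DIM('a) then a (DIM('a) - i) / unit_ball_vol (real (DIM('a) - i)) else 0)"
    (is "steiner_coeffs K ?V")
proof -
  have vol': "vol (K + cball 0 t) = (\<Sum>j\<le>DIM('a). a j * t ^ j)" if "0 \<le> t" for t
  proof (cases "t = 0")
    case True
    have "(\<lambda>k. \<Sum>j\<le>DIM('a). a j * (1 / real (Suc k)) ^ j) \<longlonglongrightarrow> (\<Sum>j\<le>DIM('a). a j * 0 ^ j)"
      using LIMSEQ_Suc[OF lim_1_over_n] by (intro tendsto_intros)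
    moreover have "(\<lambda>k. \<Sum>j\<le>DIM('a). a j * (1 / real (Suc k)) ^ j) \<longlonglongrightarrow> vol K"
      using vol_plus_cball_right_continuous_at_0[OF K] by (simp add: vol del: of_nat_Suc)
    ultimately have "vol K = (\<Sum>j\<le>DIM('a). a j * 0 ^ j)"
      using LIMSEQ_unique by blast
    then show ?thesis using True by simp
  qed (use that vol in simp)
  have "vol (K + (\<lambda>x. t *\<^sub>R x) ` cball 0 1) =
      (\<Sum>i=0..DIM('a). unit_ball_vol (real (DIM('a) - i)) * ?V i * t ^ (DIM('a) - i))" if "0 \<le> t" for t
  proof -
    have "(\<Sum>i=0..DIM('a). unit_ball_vol (real (DIM('a) - i)) * ?V i * t ^ (DIM('a) - i)) =
        (\<Sum>i=0..DIM('a). a (DIM('a) - i) * t ^ (DIM('a) - i))"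
      by (intro sum.cong) (auto simp: unit_ball_vol_neq_0 simp del: of_nat_diff)
    also have "\<dots> = (\<Sum>j\<le>DIM('a). a j * t ^ j)"
      by (rule sum_reverse)
    finally show ?thesis using that vol' by (simp add: scaleR_image_cball)
  qed
  then show ?thesis by (simp add: steiner_coeffs_def)
qed

text \<open>Interpolation writes each coefficient through finitely many volumes, which converge. The
  limits are the coefficients of a Steiner polynomial for \<open>K\<close>, whose existence is
  thereby shown; uniqueness identifies them, after division by ball volumes, with the intrinsic
  volumes.\<close>

lemma steiner_coeffs_limit:
  fixes K :: "'a::euclidean_space set"
  assumes K: "convex_body K" "K \<noteq> {}" and Z: "\<And>k. convex_body (Z k)" "\<And>k. Z k \<noteq> {}"
    and lim: "hausdorff_limit Z K"
    and vol: "\<And>k t. 0 < t \<Longrightarrow> vol (Z k + cball 0 t) = (\<Sum>j\<le>DIM('a). a k j * t ^ j)"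
    and m: "m \<le> DIM('a)"
  shows "(\<lambda>k. a k (DIM('a) - m) / unit_ball_vol (real (DIM('a) - m))) \<longlonglongrightarrow> intrinsic_volume m K"
proof -
  obtain c :: "nat \<Rightarrow> nat \<Rightarrow> real" where
    c: "\<And>a j. j \<le> DIM('a) \<Longrightarrow> a j = (\<Sum>l\<le>DIM('a). c j l * (\<Sum>i\<le>DIM('a). a i * real (Suc l) ^ i))"
    using coeffs_by_interpolation by metis
  \<comment> \<open>The interpolation formula applied to the volumes around the limit body, before
    these are known to be polynomial in the radius.\<close>
  define b where "b j = (\<Sum>l\<le>DIM('a). c j l * vol (K + cball 0 (real (Suc l))))" for j
  have ab: "(\<lambda>k. a k j) \<longlonglongrightarrow> b j" if "j \<le> DIM('a)" for j
  proof -
    have "a k j = (\<Sum>l\<le>DIM('a). c j l * vol (Z k + cball 0 (real (Suc l))))" for k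
      using c[OF that, of "a k"] vol[of "real (Suc _)" k] by simp
    then show ?thesis
      unfolding b_def using vol_plus_cball_limit[OF K Z lim]
      by (simp only:) (intro tendsto_intros, simp)
  qed
  have "vol (K + cball 0 t) = (\<Sum>j\<le>DIM('a). b j * t ^ j)" if "0 < t" for t
  proof -
    have "(\<lambda>k. vol (Z k + cball 0 t)) \<longlonglongrightarrow> (\<Sum>j\<le>DIM('a). b j * t ^ j)"
      unfolding vol[OF that] by (intro tendsto_intros ab) simp
    then show ?thesis
      using vol_plus_cball_limit[OF K Z lim that] LIMSEQ_unique by blast
  qed
  then have "intrinsic_volume m K = b (DIM('a) - m) / unit_ball_vol (real (DIM('a) - m))"
    using intrinsic_volume_eq[OF steiner_coeffsI[OF K]] m by simp
  moreover have "(\<lambda>k. a k (DIM('a) - m) / unit_ball_vol (real (DIM('a) - m))) \<longlonglongrightarrow>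
      b (DIM('a) - m) / unit_ball_vol (real (DIM('a) - m))"
    by (intro tendsto_intros ab unit_ball_vol_neq_0) simp
  ultimately show ?thesis by simp
qed

section \<open>From zonotopes to zonoids\<close>

lemma hausdorff_limitI:
  fixes K :: "'a::euclidean_space set"
  assumes K: "compact K" "K \<noteq> {}" and Z: "\<And>k. compact (Z k)" "\<And>k. Z k \<noteq> {}"
    and lim: "(\<lambda>k. hausdorff_dist (Z k) K) \<longlonglongrightarrow> 0"
  shows "hausdorff_limit Z K"
  unfolding hausdorff_limit_def
proof (intro exI conjI allI ballI)
  \<comment> \<open>Compactness bounds the distances, so the supremum really dominates each of
    them.\<close>
  have sup: "infdist a B \<le> (SUP a\<in>A. infdist a B)" if "compact A" "a \<in> A" for a and A B :: "'a set"
  proof (rule cSUP_upper[OF that(2)])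
    have "compact ((\<lambda>a. infdist a B) ` A)"
      using that(1) by (intro compact_continuous_image continuous_intros)
    then show "bdd_above ((\<lambda>a. infdist a B) ` A)"
      by (intro bounded_imp_bdd_above compact_imp_bounded)
  qed
  show "(\<lambda>k. hausdorff_dist (Z k) K) \<longlonglongrightarrow> 0" by (rule lim)
  show "infdist a K \<le> hausdorff_dist (Z k) K" if "a \<in> Z k" for a k
    using sup[OF Z(1) that, of K] unfolding hausdorff_dist_def by linarith
  show "infdist b (Z k) \<le> hausdorff_dist (Z k) K" if "b \<in> K" for b k
    using sup[OF K(1) that, of "Z k"] unfolding hausdorff_dist_def by linarith
qed

text \<open>A 1-Lipschitz map does not increase the distance to a nearest point, so the same bounds
  \<open>h\<close> serve for the images.\<close>

lemma hausdorff_limit_image: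
  fixes K :: "'a::euclidean_space set" and f :: "'a \<Rightarrow> 'b::metric_space"
  assumes K: "compact K" "K \<noteq> {}" and Z: "\<And>k. compact (Z k)" "\<And>k. Z k \<noteq> {}"
    and f: "\<And>x y. dist (f x) (f y) \<le> dist x y" and lim: "hausdorff_limit Z K"
  shows "hausdorff_limit (\<lambda>k. f ` Z k) (f ` K)"
proof -
  have image: "infdist (f a) (f ` B) \<le> infdist a B" if B: "compact B" "B \<noteq> {}" for a and B :: "'a set"
  proof -
    obtain b where "b \<in> B" "infdist a B = dist a b"
      using infdist_attains_inf[of B a] B compact_imp_closed by blast
    then show ?thesis
      using f[of a b] by (intro infdist_le2[of "f b"]) auto
  qed
  obtain h where h: "h \<longlonglongrightarrow> 0"
    "\<And>k a. a \<in> Z k \<Longrightarrow> infdist a K \<le> h k" "\<And>k b. b \<in> K \<Longrightarrow> infdist b (Z k) \<le> h k"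
    using lim by (auto simp: hausdorff_limit_def)
  show ?thesis
    unfolding hausdorff_limit_def
    by (intro exI[of _ h] conjI allI)
      (auto intro: h(1) order_trans[OF image[OF K] h(2)] order_trans[OF image[OF Z] h(3)])
qed

lemma zonotope_eq_seg_sum:
  assumes "zonotope Z"
  obtains a vs where "Z = {a} + seg_sum vs"
proof -
  obtain k :: nat and a b where Z: "Z = (\<Sum>i<k. closed_segment (a i) (b i))"
    using assms by (auto simp: zonotope_def)
  have "\<exists>c vs. (\<Sum>i<k. closed_segment (a i) (b i)) = {c} + seg_sum vs"
  proof (induction k)
    case 0
    show ?case by (intro exI[of _ 0] exI[of _ "[]"]) simp
  next
    case (Suc k)
    then obtain c vs where "(\<Sum>i<k. closed_segment (a i) (b i)) = {c} + seg_sum vs" by blast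
    moreover have "closed_segment (a k) (b k) = {a k} + seg (b k - a k)"
      using closed_segment_translation[of "a k" 0 "b k - a k"] by (simp add: singleton_plus seg_def)
    ultimately have "(\<Sum>i<Suc k. closed_segment (a i) (b i)) = ({c} + {a k}) + (seg (b k - a k) + seg_sum vs)"
      by (simp only: sum.lessThan_Suc add_ac)
    also have "{c} + {a k} = {c + a k}" by (simp add: singleton_plus)
    finally have "(\<Sum>i<Suc k. closed_segment (a i) (b i)) = {c + a k} + seg_sum ((b k - a k) # vs)"
      by simp
    then show ?case by blast
  qed
  then show ?thesis using that Z by blast
qed

theorem theorem5p1:
  fixes K :: "(real ^ 'n) set" and m :: nat
  assumes "zonoid K" and "1 \<le> m" and "m + 2 \<le> CARD('n)"
  shows "(intrinsic_volume m K)\<^sup>2 \<ge>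
    1 / (real CARD('n) - real m) *
      (\<Sum>i\<in>UNIV. (intrinsic_volume m (orth_proj (orthogonal_comp {axis i 1}) ` K))\<^sup>2)"
proof -
  let ?n = "CARD('n)"
  define P :: "'n \<Rightarrow> real ^ 'n \<Rightarrow> real ^ 'n" where "P i = drop_component (axis i 1)" for i
  have proj: "orth_proj (orthogonal_comp {axis i 1 :: real ^ 'n}) = P i" for i
    by (rule ext) (simp add: orth_proj_coordinate_hyperplane P_def drop_component_def inner_axis)
  have lin: "linear (P i)" for i
    unfolding P_def by (rule linear_drop_component)
  have lip: "dist (P i x) (P i y) \<le> dist x y" for i x y
    using norm_drop_component_le[of "axis i 1" "x - y"] linear_diff[OF lin, of i x y]
    by (simp add: P_def dist_norm)
  obtain Z where K: "convex_body K" "K \<noteq> {}" and Z: "\<And>k :: nat. zonotope (Z k)"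
    and lim: "(\<lambda>k. hausdorff_dist (Z k) K) \<longlonglongrightarrow> 0"
    using assms(1) by (auto simp: zonoid_def convex_body_def)
  obtain a vs where Z_eq: "\<And>k. Z k = {a k} + seg_sum (vs k)"
  proof -
    have "\<forall>k. \<exists>a vs. Z k = {a} + seg_sum vs"
      using zonotope_eq_seg_sum[OF Z] by blast
    then show ?thesis using that by metis
  qed
  have body: "convex_body ({b} + seg_sum ws)" "{b} + seg_sum ws \<noteq> {}" for b and ws :: "(real ^ 'n) list"
  proof -
    have "0 \<in> seg_sum ws"
    proof (induction ws)
      case (Cons w ws)
      then show ?case using set_plus_intro[of 0 "seg w" 0 "seg_sum ws"] by simp
    qed simp
    then show "{b} + seg_sum ws \<noteq> {}" by auto
  qed (simp add: convex_body_plus)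
  have Z_body: "compact (Z k)" "Z k \<noteq> {}" for k
    using body[of "a k" "vs k"] by (simp_all add: Z_eq convex_body_def)
  have hl: "hausdorff_limit Z K"
    using K Z_body lim by (intro hausdorff_limitI) (simp_all add: convex_body_def)
  \<comment> \<open>This serves for \<open>K\<close> and for each of its projections, all regarded
    as bodies in the full space: a projection is a null set there but still has a Steiner
    polynomial.\<close>
  have conv: "(\<lambda>k. ball_mixed_sum m (ws k) / unit_ball_vol (real (?n - m))) \<longlonglongrightarrow> intrinsic_volume m L"
    if L: "convex_body L" "L \<noteq> {}" and W: "hausdorff_limit (\<lambda>k. {b k} + seg_sum (ws k)) L"
    for L and b :: "nat \<Rightarrow> real ^ 'n" and ws
  proof -
    \<comment> \<open>Summation by j = n - i; the coefficient at j = n - m is then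
      \<open>ball_mixed_sum m\<close>.\<close>
    have "vol ({b k} + seg_sum (ws k) + cball 0 t) = (\<Sum>j\<le>DIM(real ^ 'n). ball_mixed_sum (?n - j) (ws k) * t ^ j)"
      if "0 < t" for k t
      unfolding vol_singleton_plus_seg_sum_plus_cball[OF that]
      using sum_reverse[of "\<lambda>j. ball_mixed_sum (?n - j) (ws k) * t ^ j" ?n]
      by (simp add: atLeast0AtMost)
    from steiner_coeffs_limit[OF L body W this, of m]
    show ?thesis using assms(3) by simp
  qed
  define \<kappa> where "\<kappa> = unit_ball_vol (real (?n - m))"
  define V where "V k = ball_mixed_sum m (vs k) / \<kappa>" for k
  define W where "W i k = ball_mixed_sum m (map (P i) (vs k)) / \<kappa>" for i k
  have V: "V \<longlonglongrightarrow> intrinsic_volume m K"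
    unfolding V_def \<kappa>_def using conv[OF K, of a vs] hl by (simp add: Z_eq[abs_def])
  have W: "W i \<longlonglongrightarrow> intrinsic_volume m (P i ` K)" for i
  proof -
    have "hausdorff_limit (\<lambda>k. P i ` Z k) (P i ` K)"
      using K Z_body lip hl by (intro hausdorff_limit_image) (simp_all add: convex_body_def)
    \<comment> \<open>A linear image of a zonotope is the zonotope of the image generators, which is
      the form that \<open>conv\<close> requires.\<close>
    then have "hausdorff_limit (\<lambda>k. {P i (a k)} + seg_sum (map (P i) (vs k))) (P i ` K)"
      by (simp add: Z_eq linear_image_set_plus[OF lin] linear_image_seg_sum[OF lin])
    moreover have "convex_body (P i ` K)"
      using K(1) lin[of i]
      by (auto simp: convex_body_def intro!: convex_linear_image compact_continuous_image linear_continuous_on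
        simp flip: linear_conv_bounded_linear)
    ultimately show ?thesis
      unfolding W_def \<kappa>_def using K(2) by (intro conv) auto
  qed
  \<comment> \<open>All squares carry the same factor 1/\<kappa>^2, so the inequality for zonotopes
    is the one for \<open>ball_mixed_sum\<close>.\<close>
  have ineq: "(\<Sum>i\<in>UNIV. (W i k)\<^sup>2) \<le> (real ?n - real m) * (V k)\<^sup>2" for k
  proof -
    have Basis: "Basis = (\<lambda>i. axis i 1 :: real ^ 'n) ` UNIV"
      by (auto simp: Basis_vec_def)
    have "(\<Sum>i\<in>UNIV. (ball_mixed_sum m (map (P i) (vs k)))\<^sup>2) =
        (\<Sum>e\<in>Basis. (ball_mixed_sum m (map (drop_component e) (vs k)))\<^sup>2)"
      unfolding Basis P_def by (subst sum.reindex) (auto simp: inj_on_def axis_eq_axis)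
    also have "\<dots> \<le> (real ?n - real m) * (ball_mixed_sum m (vs k))\<^sup>2"
      using sum_ball_mixed_sum_drop_component[of m "vs k"] assms(3) by simp
    finally show ?thesis
      unfolding V_def W_def power_divide sum_divide_distrib[symmetric] times_divide_eq_right
      by (rule divide_right_mono) simp
  qed
  have "(\<Sum>i\<in>UNIV. (intrinsic_volume m (P i ` K))\<^sup>2) \<le> (real ?n - real m) * (intrinsic_volume m K)\<^sup>2"
    using ineq by (intro LIMSEQ_le[of "\<lambda>k. \<Sum>i\<in>UNIV. (W i k)\<^sup>2" _ "\<lambda>k. (real ?n - real m) * (V k)\<^sup>2"])
      (auto intro!: tendsto_intros V W)
  then show ?thesis
    using assms(3) by (simp add: proj field_simps)
qed

end
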